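(* Let $\alpha \in (0,1)$ and let $X$ and $Y$ be Hilbert spaces. Suppose that $T \in \mathcal{L}(X)$ is a contractive operator which is the cogenerator of a contractive $C_0$-semigroup $(T(t))_{t\ge0}$ on $X$, and let $A$ be the generator of $(T(t))_{t \ge 0}$, so that $T = (I+A)(I-A)^{-1}$. Suppose that for each $C \in \mathcal{L}(D(A),Y)$ the continuous resolvent condition $$\sup_{\lambda \in \mathbb{C}_+} (\mathrm{Re}\,\lambda)^{\frac{1-\alpha}{2}} \|C R(\lambda,A)\|_{\mathcal{L}(X,Y)} < \infty$$ implies that $C$ is $\alpha$-admissible for $A$, i.e. that there exists $M>0$ with $$\int_0^\infty t^\alpha \|C T(t) x_0\|_Y^2 \, dt \leq M^2 \|x_0\|_X^2 \quad \text{for all } x_0 \in D(A).$$ Then for each $D \in \mathcal{L}(X,Y)$ the discrete resolvent condition $$\sup_{\omega \in \mathbb{D}} (1-|\omega|^2)^{\frac{1-\alpha}{2}} \|D(I-\bar\omega T)^{-1}\|_{\mathcal{L}(X,Y)} < \infty$$ implies that $D$ is discrete $\alpha$-admissible for $T$, i.e. that there exists $M>0$ with $$\sum_{n=0}^\infty (1+n)^\alpha \|D T^n x\|_Y^2 \leq M^2 \|x\|_X^2 \quad \text{for all } x \in X.$$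
   Context: Hilbert spaces are complex. $\mathbb{C}_+ = \{\lambda \in \mathbb{C} : \mathrm{Re}\,\lambda > 0\}$ and $\mathbb{D}$ is the open unit disc. $R(\lambda,A) = (\lambda I - A)^{-1}$. $D(A)$ denotes the domain of $A$ with the graph norm $\|x\|_{D(A)} = \|x\|_X + \|Ax\|_X$, and $\mathcal{L}(D(A),Y)$ is the space of operators bounded from $D(A)$ with this norm into $Y$. A contraction $T$ (meaning $\|T\|_{\mathcal{L}(X)} \le 1$) is called the cogenerator of a contractive $C_0$-semigroup if $T = (I+A)(I-A)^{-1}$, where $A$ is the generator of that semigroup; a contractive semigroup is one with $\|T(t)\|_{\mathcal{L}(X)}\le 1$ for all $t\ge 0$. Here $T$ without argument is the cogenerator and $T(t)$ is the semigroup. *)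

theory Defs
  imports "HOL-Analysis.Analysis"
begin

text \<open>Complex inner product spaces, with inner product linear in the first argument. They are
  obtained by enriching the library's real inner product spaces: the norm, metric and topology are
  those of \<^class>\<open>real_inner\<close>, whose inner product is the real part of the complex one,
  so that the norm of x is the square root of \<^term>\<open>cinner x x\<close>.\<close>

class complex_inner = real_inner +
  fixes scaleC :: "complex \<Rightarrow> 'a \<Rightarrow> 'a"  (infixr "*\<^sub>C" 75)
    and cinner :: "'a \<Rightarrow> 'a \<Rightarrow> complex"
  assumes scaleC_add_right: "c *\<^sub>C (x + y) = c *\<^sub>C x + c *\<^sub>C y"
    and scaleC_add_left: "(c + d) *\<^sub>C x = c *\<^sub>C x + d *\<^sub>C x"
    and scaleC_scaleC: "c *\<^sub>C d *\<^sub>C x = (c * d) *\<^sub>C x"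
    and scaleC_of_real: "complex_of_real r *\<^sub>C x = scaleR r x"
    and cinner_commute: "cinner x y = cnj (cinner y x)"
    and cinner_add_left: "cinner (x + y) z = cinner x z + cinner y z"
    and cinner_scaleC_left: "cinner (c *\<^sub>C x) y = c * cinner x y"
    and Re_cinner: "Re (cinner x y) = inner x y"

class chilbert_space = complex_inner + complete_space

instantiation complex :: chilbert_space
begin
definition scaleC_complex :: "complex \<Rightarrow> complex \<Rightarrow> complex"
  where "scaleC_complex c x = c * x"
definition cinner_complex :: "complex \<Rightarrow> complex \<Rightarrow> complex"
  where "cinner_complex x y = x * cnj y"
instance
  by standard
    (simp_all add: scaleC_complex_def cinner_complex_def algebra_simps scaleR_conv_of_real
      inner_complex_def)
end

lemma cinner_self:
  fixes x :: "'a::complex_inner"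
  shows "cinner x x = complex_of_real ((norm x)\<^sup>2)"
proof -
  have "Im (cinner x x) = 0"
    using arg_cong[OF cinner_commute[of x x], of Im] by simp
  then show ?thesis
    by (simp add: complex_eq_iff Re_cinner power2_norm_eq_inner)
qed

definition bounded_clinear :: "('a::complex_inner \<Rightarrow> 'b::complex_inner) \<Rightarrow> bool"
  where "bounded_clinear f \<longleftrightarrow> bounded_linear f \<and> (\<forall>c x. f (c *\<^sub>C x) = c *\<^sub>C f x)"

text \<open>An unbounded operator is given by its domain together with a total function, only the values
  of which on the domain matter. The following is the space of operators that are bounded from the
  domain of A, with the graph norm, into Y.\<close>

definition bounded_on_domain ::
  "'a set \<Rightarrow> ('a::complex_inner \<Rightarrow> 'a) \<Rightarrow> ('a \<Rightarrow> 'b::complex_inner) \<Rightarrow> bool"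
  where "bounded_on_domain DA A C \<longleftrightarrow>
    (\<forall>x\<in>DA. \<forall>y\<in>DA. C (x + y) = C x + C y) \<and>
    (\<forall>c. \<forall>x\<in>DA. C (c *\<^sub>C x) = c *\<^sub>C C x) \<and>
    (\<exists>K. \<forall>x\<in>DA. norm (C x) \<le> K * (norm x + norm (A x)))"

text \<open>The inverse of \<open>\<lambda>I - A\<close> on D(A). It is the genuine inverse whenever that map is a bijection
  from D(A) onto the space, in particular for \<open>Re \<lambda> > 0\<close> if A generates a contractive
  semigroup.\<close>

definition resolvent ::
  "'a set \<Rightarrow> ('a::complex_inner \<Rightarrow> 'a) \<Rightarrow> complex \<Rightarrow> 'a \<Rightarrow> 'a"
  where "resolvent DA A l = inv_into DA (\<lambda>x. l *\<^sub>C x - A x)"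

text \<open>Semigroups are indexed by all reals, but only nonnegative times are constrained or used.\<close>

definition C0_semigroup :: "(real \<Rightarrow> 'a::complex_inner \<Rightarrow> 'a) \<Rightarrow> bool"
  where "C0_semigroup S \<longleftrightarrow>
    (\<forall>t\<ge>0. bounded_clinear (S t)) \<and>
    S 0 = id \<and>
    (\<forall>s\<ge>0. \<forall>t\<ge>0. S (s + t) = S s \<circ> S t) \<and>
    (\<forall>x. ((\<lambda>t. S t x) \<longlongrightarrow> x) (at_right 0))"

definition contractive_C0_semigroup :: "(real \<Rightarrow> 'a::complex_inner \<Rightarrow> 'a) \<Rightarrow> bool"
  where "contractive_C0_semigroup S \<longleftrightarrow> C0_semigroup S \<and> (\<forall>t\<ge>0. onorm (S t) \<le> 1)"

definition generator_dom :: "(real \<Rightarrow> 'a::complex_inner \<Rightarrow> 'a) \<Rightarrow> 'a set"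
  where "generator_dom S = {x. \<exists>y. ((\<lambda>h. (S h x - x) /\<^sub>R h) \<longlongrightarrow> y) (at_right 0)}"

definition generator :: "(real \<Rightarrow> 'a::complex_inner \<Rightarrow> 'a) \<Rightarrow> 'a \<Rightarrow> 'a"
  where "generator S x = Lim (at_right 0) (\<lambda>h. (S h x - x) /\<^sub>R h)"

definition cogenerator_of :: "('a::complex_inner \<Rightarrow> 'a) \<Rightarrow> (real \<Rightarrow> 'a \<Rightarrow> 'a) \<Rightarrow> bool"
  where "cogenerator_of T S \<longleftrightarrow>
    T = (\<lambda>x. x + generator S x) \<circ> resolvent (generator_dom S) (generator S) 1"

definition continuous_resolvent_condition ::
  "real \<Rightarrow> (real \<Rightarrow> 'a::complex_inner \<Rightarrow> 'a) \<Rightarrow> ('a \<Rightarrow> 'b::complex_inner) \<Rightarrow> bool"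
  where "continuous_resolvent_condition \<alpha> S C \<longleftrightarrow>
    bdd_above ((\<lambda>l. Re l powr ((1 - \<alpha>) / 2) *
        onorm (C \<circ> resolvent (generator_dom S) (generator S) l)) ` {l. Re l > 0})"

definition admissible ::
  "real \<Rightarrow> (real \<Rightarrow> 'a::complex_inner \<Rightarrow> 'a) \<Rightarrow> ('a \<Rightarrow> 'b::complex_inner) \<Rightarrow> bool"
  where "admissible \<alpha> S C \<longleftrightarrow>
    (\<exists>M>0. \<forall>x\<in>generator_dom S.
      (\<integral>\<^sup>+t\<in>{0..}. ennreal (t powr \<alpha> * (norm (C (S t x)))\<^sup>2) \<partial>lborel)
        \<le> ennreal (M\<^sup>2 * (norm x)\<^sup>2))"

definition discrete_resolvent_condition ::
  "real \<Rightarrow> ('a::complex_inner \<Rightarrow> 'a) \<Rightarrow> ('a \<Rightarrow> 'b::complex_inner) \<Rightarrow> bool"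
  where "discrete_resolvent_condition \<alpha> T D \<longleftrightarrow>
    bdd_above ((\<lambda>w. (1 - (cmod w)\<^sup>2) powr ((1 - \<alpha>) / 2) *
        onorm (D \<circ> inv (\<lambda>x. x - cnj w *\<^sub>C T x))) ` {w. cmod w < 1})"

definition discrete_admissible ::
  "real \<Rightarrow> ('a::complex_inner \<Rightarrow> 'a) \<Rightarrow> ('a \<Rightarrow> 'b::complex_inner) \<Rightarrow> bool"
  where "discrete_admissible \<alpha> T D \<longleftrightarrow>
    (\<exists>M>0. \<forall>x.
      (\<Sum>n. ennreal ((1 + real n) powr \<alpha> * (norm (D ((T ^^ n) x)))\<^sup>2))
        \<le> ennreal (M\<^sup>2 * (norm x)\<^sup>2))"

end

theory Submission
  imports Defs
begin

text \<open>Given D, put \<open>C = D(I - A)\<^sup>1\<^sup>+\<^sup>\<alpha>\<close>. The discrete resolvent condition says that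
  \<open>D(I - A)R(\<lambda>, A)\<close> has norm at most a constant times
  \<open>(Re \<lambda>)\<^sup>-\<^sup>(\<^sup>1\<^sup>-\<^sup>\<alpha>\<^sup>)\<^sup>/\<^sup>2 |1 + \<lambda>|\<^sup>-\<^sup>\<alpha>\<close>. As \<open>\<alpha> < (1 + \<alpha>)/2\<close>, this decay for real \<open>\<lambda>\<close> makes
  \<open>B = D(I - A)\<^sup>\<alpha>\<close> bounded, so C is bounded on D(A), and the resolvent identity turns it into the
  continuous resolvent condition for C. Hence C is admissible. The generating function of the
  Laguerre polynomials gives
  \<open>C T(t) = c \<Sum>\<^sub>n (-1)\<^sup>n e\<^sup>-\<^sup>t L\<^sub>n\<^sup>(\<^sup>\<alpha>\<^sup>)(2t) D T\<^sup>n\<close>, where the functions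
  \<open>e\<^sup>-\<^sup>t L\<^sub>n\<^sup>(\<^sup>\<alpha>\<^sup>)(2t)\<close> are orthogonal for the weight \<open>t\<^sup>\<alpha>\<close>, with squared norms of order
  \<open>(1 + n)\<^sup>\<alpha>\<close>. The Bessel inequality for the coefficients \<open>D T\<^sup>n x\<close> is the claim.\<close>

section \<open>Integration over the half line\<close>

text \<open>No unbounded fractional power is ever formed: \<open>J 1\<close> is (I - A)^-1,
  \<open>E l\<close> is the bounded operator (I - A)R(l, A), and \<open>B\<close> is D(I -
  A)^\<alpha> up to the constant \<open>\<kappa>\<close>, given by an integral of D E(1 + s) over s
  > 0. The exponent 1 + \<alpha> of C is dictated by the weight t^\<alpha>: the integral of
  t^(\<alpha>+k) e^-t T(t) is Gamma(\<alpha>+k+1) (I - A)^-(\<alpha>+k+1), so the moments of C T(t)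
  against t^(\<alpha>+k) e^-t contain only integer powers of (I - A)^-1. Since T = 2(I - A)^-1 - I,
  the Laguerre combinations of these moments are exactly multiples of D T^n. The expansion of C T(t)
  itself is never summed: the Bessel inequality asks for orthogonality and coefficients, not for
  convergence or completeness. Vector-valued identities are tested against fixed vectors, which
  reduces them to scalar integrals and Fubini's theorem.\<close>

abbreviation half_line :: "real measure"
  where "half_line \<equiv> restrict_space lborel {0<..}"

lemma sigma_finite_half_line: "sigma_finite_measure half_line"
  by (intro sigma_finite_measure_restrict_space sigma_finite_lborel) auto

interpretation half_line: sigma_finite_measure half_line
  by (rule sigma_finite_half_line)

interpretation half_line_pair: pair_sigma_finite half_line half_line ..

lemma space_half_line [simp]: "space half_line = {0<..}"
  by (simp add: space_restrict_space)

lemma measurable_half_line_continuous: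
  fixes f :: "real \<Rightarrow> 'b::topological_space"
  shows "continuous_on {0<..} f \<Longrightarrow> f \<in> borel_measurable half_line"
  using borel_measurable_continuous_on_restrict[of "{0<..}" f]
  by (simp add: measurable_def space_restrict_space sets_restrict_space)

lemma measurable_half_line_borel [measurable (raw)]:
  assumes "f \<in> borel_measurable borel"
  shows "f \<in> borel_measurable half_line"
  using assms by (intro measurable_restrict_space1) simp

lemma has_bochner_integral_half_line_HK:
  fixes f :: "real \<Rightarrow> real"
  assumes "f \<in> borel_measurable half_line" and nonneg: "\<And>x. x > 0 \<Longrightarrow> 0 \<le> f x"
    and I: "(f has_integral I) {0<..}"
  shows "has_bochner_integral half_line f I"
proof (rule has_bochner_integral_nn_integral)
  have "(\<integral>\<^sup>+x. ennreal (f x) \<partial>half_line) = (\<integral>\<^sup>+x. ennreal (f x) * indicator {0<..} x \<partial>lborel)"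
    by (subst nn_integral_restrict_space) auto
  also have "\<dots> = ennreal I"
    using nonneg I by (intro nn_integral_has_integral_lebesgue') auto
  finally show "(\<integral>\<^sup>+x. ennreal (f x) \<partial>half_line) = ennreal I" .
  show "0 \<le> I"
    using nonneg by (intro has_integral_nonneg[OF I]) auto
qed (use assms in \<open>auto intro!: AE_I2\<close>)

lemma has_integral_half_line_closed:
  fixes f :: "real \<Rightarrow> real"
  assumes "(f has_integral I) {0..}"
  shows "(f has_integral I) {0<..}"
proof -
  have "((\<lambda>t. if t \<in> {0<..} then f t else 0) has_integral I) {0..}"
    by (rule has_integral_spike[OF _ _ assms, of "{0}"]) auto
  then show ?thesis
    by (subst (asm) has_integral_restrict) auto
qed

section \<open>Gamma and Beta integrals\<close>

lemma has_bochner_integral_Gamma: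
  fixes a c :: real
  assumes a: "a > 0" and c: "c > 0"
  shows "has_bochner_integral half_line (\<lambda>t. t powr (a - 1) * exp (- (c * t))) (Gamma a / c powr a)"
proof -
  let ?f = "\<lambda>t::real. indicator {0<..} t * (t powr (a - 1) * exp (- t))"
  have "has_bochner_integral half_line (\<lambda>t. t powr (a - 1) * exp (- t)) (Gamma a)"
  proof (rule has_bochner_integral_half_line_HK)
    show "((\<lambda>t. t powr (a - 1) * exp (- t)) has_integral Gamma a) {0<..}"
      using has_integral_half_line_closed[OF Gamma_integral_real[OF a]]
      by (simp add: exp_minus field_simps)
  qed auto
  then have "has_bochner_integral lborel ?f (Gamma a)"
    by (simp add: has_bochner_integral_iff integrable_restrict_space integral_restrict_space)
  then have "has_bochner_integral lborel (\<lambda>t. ?f (0 + c * t)) (Gamma a /\<^sub>R \<bar>c\<bar>)"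
    using c by (subst (asm) lborel_has_bochner_integral_real_affine_iff[of c _ _ 0]) auto
  \<comment> \<open>The factor undoes the c^(a-1) that the substitution t -> c t leaves in (c
    t)^(a-1).\<close>
  then have "has_bochner_integral lborel (\<lambda>t. c powr (1 - a) * ?f (0 + c * t)) (c powr (1 - a) * (Gamma a /\<^sub>R \<bar>c\<bar>))"
    by (intro has_bochner_integral_mult_right)
  moreover have "(\<lambda>t. c powr (1 - a) * ?f (0 + c * t)) = (\<lambda>t. indicator {0<..} t * (t powr (a - 1) * exp (- (c * t))))"
    using c by (auto simp: fun_eq_iff indicator_def zero_less_mult_iff powr_mult powr_diff field_simps)
  moreover have "c powr (1 - a) * (Gamma a /\<^sub>R \<bar>c\<bar>) = Gamma a / c powr a"
    using c by (simp add: powr_diff field_simps)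
  ultimately have "has_bochner_integral lborel
      (\<lambda>t. indicator {0<..} t * (t powr (a - 1) * exp (- (c * t)))) (Gamma a / c powr a)"
    by (simp only:)
  then show ?thesis
    by (simp add: has_bochner_integral_iff integrable_restrict_space integral_restrict_space)
qed

lemma has_bochner_integral_Beta_scaled:
  fixes a b v :: real
  assumes a: "a > 0" and b: "b > 0" and v: "v > 0"
  shows "has_bochner_integral lborel
    (\<lambda>t. indicator {0<..<v} t * (t powr (a - 1) * (v - t) powr (b - 1))) (Beta a b * v powr (a + b - 1))"
proof -
  let ?f = "\<lambda>t::real. indicator {0<..<1} t * (t powr (a - 1) * (1 - t) powr (b - 1))"
  have "((\<lambda>t. t powr (a - 1) * (1 - t) powr (b - 1)) has_integral Beta a b) {0<..<1}"
    using has_integral_Beta_real[OF a b] by (simp add: has_integral_Icc_iff_Ioo)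
  then have "(\<integral>\<^sup>+t. ennreal (t powr (a - 1) * (1 - t) powr (b - 1)) * indicator {0<..<1} t \<partial>lborel) = ennreal (Beta a b)"
    by (intro nn_integral_has_integral_lebesgue') auto
  moreover have "(\<integral>\<^sup>+t. ennreal (t powr (a - 1) * (1 - t) powr (b - 1)) * indicator {0<..<1} t \<partial>lborel)
      = (\<integral>\<^sup>+t. ennreal (?f t) \<partial>lborel)"
    by (intro nn_integral_cong) (auto simp: indicator_def)
  ultimately have "has_bochner_integral lborel ?f (Beta a b)"
    using a b by (intro has_bochner_integral_nn_integral) (auto simp: Beta_def intro!: Gamma_real_pos less_imp_le divide_pos_pos mult_pos_pos)
  then have "has_bochner_integral lborel (\<lambda>t. ?f (0 + (1 / v) * t)) (Beta a b /\<^sub>R \<bar>1 / v\<bar>)"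
    using v by (subst (asm) lborel_has_bochner_integral_real_affine_iff[of "1 / v" _ _ 0]) auto
  then have "has_bochner_integral lborel (\<lambda>t. v powr (a + b - 2) * ?f (0 + (1 / v) * t))
      (v powr (a + b - 2) * (Beta a b /\<^sub>R \<bar>1 / v\<bar>))"
    by (intro has_bochner_integral_mult_right)
  moreover have "v powr (a + b - 2) * ?f (0 + (1 / v) * t)
      = indicator {0<..<v} t * (t powr (a - 1) * (v - t) powr (b - 1))" for t
  proof (cases "0 < t \<and> t < v")
    case True
    have "1 - t / v = (v - t) / v" using v by (simp add: field_simps)
    then have "?f (0 + (1 / v) * t) = (t powr (a - 1) / v powr (a - 1)) * ((v - t) powr (b - 1) / v powr (b - 1))"
      using True v by (simp add: indicator_def powr_divide)
    moreover have "v powr (a + b - 2) = v powr (a - 1) * v powr (b - 1)"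
      by (simp add: powr_add [symmetric])
    ultimately show ?thesis using True v by simp
  qed (use v in \<open>auto simp: indicator_def field_simps\<close>)
  moreover have "v powr (a + b - 2) * (Beta a b /\<^sub>R \<bar>1 / v\<bar>) = Beta a b * v powr (a + b - 1)"
  proof -
    have "v powr (a + b - 1) = v powr (a + b - 2) * v powr 1" by (simp only: powr_add [symmetric]) simp
    then show ?thesis using v by simp
  qed
  ultimately show ?thesis by (simp only:)
qed

lemma integral_half_line_shift:
  fixes f :: "real \<Rightarrow> real"
  shows "(\<integral>u. f (t + u) \<partial>half_line) = (\<integral>v. indicator {t<..} v * f v \<partial>lborel)"
proof -
  have "(\<integral>u. f (t + u) \<partial>half_line) = (\<integral>u. indicator {t<..} (t + 1 * u) * f (t + 1 * u) \<partial>lborel)"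
    by (subst integral_restrict_space) (auto intro!: Bochner_Integration.integral_cong simp: indicator_def)
  also have "\<dots> = (\<integral>v. indicator {t<..} v * f v \<partial>lborel)"
    by (subst lborel_integral_real_affine[of 1 _ t]) auto
  finally show ?thesis .
qed

text \<open>With v = t + u this is Fubini on the triangle 0 < t < v, where the inner integral is a
  Beta integral. Up to Gamma factors the powers t^(a-1) form a convolution semigroup; applied to
  \<open>S\<close>, this is how fractional powers of (I - A)^-1 are multiplied.\<close>

lemma Beta_convolution:
  fixes m :: "real \<Rightarrow> real"
  assumes a: "a > 0" and b: "b > 0" and m [measurable]: "m \<in> borel_measurable half_line"
    and int: "integrable half_line (\<lambda>v. v powr (a + b - 1) * m v)"
  shows "(\<integral>t. t powr (a - 1) * (\<integral>u. u powr (b - 1) * m (t + u) \<partial>half_line) \<partial>half_line)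
    = Beta a b * (\<integral>v. v powr (a + b - 1) * m v \<partial>half_line)"
proof -
  define m' where "m' v = indicator {0<..} v * m v" for v
  have m' [measurable]: "m' \<in> borel_measurable borel"
    using m unfolding m'_def by (subst (asm) borel_measurable_restrict_space_iff) auto
  \<comment> \<open>The integrand after the substitution u = v - t, cut off to the triangle. As
    \<open>m'\<close> extends \<open>m\<close> by zero, Fubini can run over the whole plane.\<close>
  define K where "K = (\<lambda>(v::real, t::real). indicator {0<..<v} t * (t powr (a - 1) * (v - t) powr (b - 1)) * m' v)"
  have "K = (\<lambda>p. (if 0 < snd p \<and> snd p < fst p then 1 else 0)
      * (snd p powr (a - 1) * (fst p - snd p) powr (b - 1)) * m' (fst p))"
    by (auto simp: K_def fun_eq_iff indicator_def)
  moreover have "\<dots> \<in> borel_measurable (lborel \<Otimes>\<^sub>M lborel)"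
    by measurable
  ultimately have K_meas [measurable]: "K \<in> borel_measurable (lborel \<Otimes>\<^sub>M lborel)" by simp
  have inner: "has_bochner_integral lborel (\<lambda>t. K (v, t)) (Beta a b * v powr (a + b - 1) * m' v)" for v
  proof (cases "v > 0")
    case True
    then show ?thesis
      unfolding K_def using has_bochner_integral_mult_left[OF has_bochner_integral_Beta_scaled[OF a b True], of "m' v"]
      by simp
  next
    case False
    then have "m' v = 0" by (simp add: m'_def)
    then show ?thesis by (simp add: K_def has_bochner_integral_zero)
  qed
  have int': "integrable lborel (\<lambda>v. v powr (a + b - 1) * m' v)"
    using int by (simp add: integrable_restrict_space m'_def mult_ac)
  have K_int: "integrable (lborel \<Otimes>\<^sub>M lborel) K"
  proof (rule lborel_pair.Fubini_integrable)
    have "(\<lambda>v. \<integral>t. norm (K (v, t)) \<partial>lborel) = (\<lambda>v. Beta a b * norm (v powr (a + b - 1) * m' v))"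
    proof
      fix v
      have "(\<integral>t. norm (K (v, t)) \<partial>lborel)
        = (\<integral>t. indicator {0<..<v} t * (t powr (a - 1) * (v - t) powr (b - 1)) * \<bar>m' v\<bar> \<partial>lborel)"
        by (intro Bochner_Integration.integral_cong) (auto simp: K_def abs_mult)
      also have "\<dots> = Beta a b * norm (v powr (a + b - 1) * m' v)"
      proof (cases "v > 0")
        case True
        then show ?thesis
          using has_bochner_integral_integral_eq[OF has_bochner_integral_mult_left[OF has_bochner_integral_Beta_scaled[OF a b True], of "\<bar>m' v\<bar>"]]
          by (simp add: abs_mult)
      qed (simp add: m'_def)
      finally show "(\<integral>t. norm (K (v, t)) \<partial>lborel) = Beta a b * norm (v powr (a + b - 1) * m' v)" .
    qed
    then show "integrable lborel (\<lambda>v. \<integral>t. norm (K (v, t)) \<partial>lborel)"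
      using int' by simp
    show "AE v in lborel. integrable lborel (\<lambda>t. K (v, t))"
      using inner by (auto simp: has_bochner_integral_iff)
  qed simp
  have "(\<integral>t. t powr (a - 1) * (\<integral>u. u powr (b - 1) * m (t + u) \<partial>half_line) \<partial>half_line)
      = (\<integral>t. (\<integral>v. K (v, t) \<partial>lborel) \<partial>lborel)"
  proof (subst integral_restrict_space, simp, rule Bochner_Integration.integral_cong[OF refl])
    fix t :: real
    show "indicator {0<..} t *\<^sub>R (t powr (a - 1) * (\<integral>u. u powr (b - 1) * m (t + u) \<partial>half_line)) = (\<integral>v. K (v, t) \<partial>lborel)"
    proof (cases "t > 0")
      case True
      have "t powr (a - 1) * (\<integral>u. u powr (b - 1) * m (t + u) \<partial>half_line)
          = t powr (a - 1) * (\<integral>v. indicator {t<..} v * ((v - t) powr (b - 1) * m v) \<partial>lborel)"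
        using integral_half_line_shift[of "\<lambda>v. (v - t) powr (b - 1) * m v" t] by simp
      also have "\<dots> = (\<integral>v. t powr (a - 1) * (indicator {t<..} v * ((v - t) powr (b - 1) * m v)) \<partial>lborel)"
        by simp
      also have "\<dots> = (\<integral>v. K (v, t) \<partial>lborel)"
        using True by (intro Bochner_Integration.integral_cong) (auto simp: K_def m'_def indicator_def)
      finally show ?thesis using True by simp
    qed (simp add: K_def indicator_def)
  qed
  also have "\<dots> = (\<integral>v. (\<integral>t. K (v, t) \<partial>lborel) \<partial>lborel)"
    using lborel_pair.Fubini_integral[of "\<lambda>v t. K (v, t)"] K_int by simp
  also have "\<dots> = (\<integral>v. Beta a b * (v powr (a + b - 1) * m' v) \<partial>lborel)"
    using inner by (intro Bochner_Integration.integral_cong) (auto simp: has_bochner_integral_iff mult_ac)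
  also have "\<dots> = Beta a b * (\<integral>v. v powr (a + b - 1) * m v \<partial>half_line)"
    by (subst integral_mult_right_zero) (simp add: integral_restrict_space m'_def mult_ac)
  finally show ?thesis .
qed

section \<open>Laguerre functions and the Bessel inequality\<close>

text \<open>Pascal's rule: an (n+1)-st finite difference is the n-th difference of the first
  difference. The sign (-1)^(n + i) is (-1)^(n - i) without subtraction on the naturals. The
  identity serves twice, for the orthogonality of the Laguerre functions and for the powers of T = 2
  J 1 - I.\<close>

lemma alternating_binomial_sum_Suc:
  fixes F :: "nat \<Rightarrow> 'a::comm_ring_1"
  shows "(\<Sum>i\<le>Suc n. (-1) ^ (Suc n + i) * of_nat (Suc n choose i) * F i)
    = (\<Sum>i\<le>n. (-1) ^ (n + i) * of_nat (n choose i) * (F (Suc i) - F i))"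
proof -
  have "(\<Sum>i\<le>Suc n. (-1) ^ (Suc n + i) * of_nat (Suc n choose i) * F i)
      = (-1) ^ Suc n * F 0 + (\<Sum>i\<le>n. (-1) ^ (n + i) * of_nat (n choose Suc i) * F (Suc i))
        + (\<Sum>i\<le>n. (-1) ^ (n + i) * of_nat (n choose i) * F (Suc i))"
    by (subst sum.atMost_Suc_shift) (simp add: algebra_simps sum.distrib sum_subtractf sum_negf)
  also have "(-1) ^ Suc n * F 0 + (\<Sum>i\<le>n. (-1) ^ (n + i) * of_nat (n choose Suc i) * F (Suc i))
      = (\<Sum>i\<le>Suc n. (-1) ^ (Suc n + i) * of_nat (n choose i) * F i)"
    by (subst sum.atMost_Suc_shift) (simp add: algebra_simps)
  also have "\<dots> = - (\<Sum>i\<le>n. (-1) ^ (n + i) * of_nat (n choose i) * F i)"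
    by (simp add: sum_negf binomial_eq_0)
  finally show ?thesis
    by (simp add: algebra_simps sum_subtractf)
qed

text \<open>This is an n-th finite difference of a monic polynomial of degree j in i. Each
  difference lowers the length of a rising factorial by one and shifts its base.\<close>

lemma alternating_binomial_sum_pochhammer:
  fixes a :: "'a::{comm_ring_1, ring_char_0}"
  assumes "j \<le> n"
  shows "(\<Sum>i\<le>n. (-1) ^ (n + i) * of_nat (n choose i) * pochhammer (a + of_nat i) j)
    = (if j = n then fact n else 0)"
  using assms
proof (induction n arbitrary: a j)
  case 0
  then show ?case by simp
next
  case (Suc n)
  show ?case
  proof (cases j)
    case 0
    then show ?thesis by (subst alternating_binomial_sum_Suc) simp
  next
    case (Suc k)
    have diff: "pochhammer (b + 1) (Suc k) - pochhammer b (Suc k) = of_nat (Suc k) * pochhammer (b + 1) k" for b :: 'a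
    proof -
      have "pochhammer (b + 1) (Suc k) = pochhammer (b + 1) k * (b + 1 + of_nat k)"
        by (rule pochhammer_Suc)
      moreover have "pochhammer b (Suc k) = b * pochhammer (b + 1) k"
        by (rule pochhammer_rec)
      ultimately show ?thesis by (simp add: algebra_simps)
    qed
    have "(\<Sum>i\<le>Suc n. (-1) ^ (Suc n + i) * of_nat (Suc n choose i) * pochhammer (a + of_nat i) j)
        = (\<Sum>i\<le>n. (-1) ^ (n + i) * of_nat (n choose i) * (of_nat (Suc k) * pochhammer ((a + 1) + of_nat i) k))"
      unfolding alternating_binomial_sum_Suc Suc
      using diff[of "a + of_nat _"] by (intro sum.cong refl) (simp add: add_ac)
    also have "\<dots> = of_nat (Suc k) * (\<Sum>i\<le>n. (-1) ^ (n + i) * of_nat (n choose i) * pochhammer ((a + 1) + of_nat i) k)"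
      by (simp only: sum_distrib_left mult_ac)
    also have "\<dots> = (if j = Suc n then fact (Suc n) else 0)"
      using Suc Suc.prems by (subst Suc.IH) auto
    finally show ?thesis .
  qed
qed

lemma Gamma_real_plus1: "x > 0 \<Longrightarrow> Gamma (x + 1) = x * Gamma (x :: real)"
  by (intro Gamma_plus1) (auto elim!: nonpos_Ints_cases)

text \<open>Up to the factor \<open>(-1)\<^sup>n n! / \<Gamma>(\<alpha> + n + 1)\<close>, this is the generalised Laguerre polynomial
  \<open>L\<^sub>n\<^sup>(\<^sup>\<alpha>\<^sup>)(2t)\<close>.\<close>

definition laguerre :: "real \<Rightarrow> nat \<Rightarrow> real \<Rightarrow> real"
  where "laguerre \<alpha> n t =
    (\<Sum>i\<le>n. (-1) ^ (n + i) * real (n choose i) * 2 ^ i / Gamma (\<alpha> + real i + 1) * t ^ i)"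

text \<open>Squared norm of e^-t \<open>laguerre \<alpha> n t\<close> for the weight t^\<alpha>. The
  normalisation of \<open>laguerre\<close> makes the coefficients of the output a constant times D
  T^n, with no factor depending on n, so the weight (1 + n)^\<alpha> of the conclusion has to come
  from the reciprocal of this number.\<close>

definition laguerre_norm :: "real \<Rightarrow> nat \<Rightarrow> real"
  where "laguerre_norm \<alpha> n = fact n / (2 powr (\<alpha> + 1) * Gamma (\<alpha> + real n + 1))"

lemma has_bochner_integral_Gamma_power:
  fixes \<alpha> c :: real
  assumes "\<alpha> > -1" and "c > 0"
  shows "has_bochner_integral half_line (\<lambda>t. t powr \<alpha> * exp (- (c * t)) * t ^ k)
    (Gamma (\<alpha> + real k + 1) / c powr (\<alpha> + real k + 1))"
proof -
  have "has_bochner_integral half_line (\<lambda>t. t powr (\<alpha> + real k + 1 - 1) * exp (- (c * t)))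
    (Gamma (\<alpha> + real k + 1) / c powr (\<alpha> + real k + 1))"
    using assms by (intro has_bochner_integral_Gamma) auto
  then show ?thesis
    by (rule iffD1[OF has_bochner_integral_cong, rotated -1])
      (auto simp: powr_add powr_realpow)
qed

text \<open>Termwise integration produces the quotients Gamma(\<alpha>+i+j+1) / Gamma(\<alpha>+i+1),
  which are rising factorials of length j. The factors 2^i of the coefficients cancel against those
  from the exponential e^(-2t), and an n-th finite difference remains.\<close>

lemma laguerre_power_integral:
  fixes \<alpha> :: real
  assumes \<alpha>: "\<alpha> > -1" and "j \<le> n"
  shows "has_bochner_integral half_line (\<lambda>t. t powr \<alpha> * exp (- (2 * t)) * laguerre \<alpha> n t * t ^ j)
    ((if j = n then fact n else 0) / 2 powr (\<alpha> + real j + 1))"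
proof -
  let ?c = "\<lambda>i. (-1) ^ (n + i) * real (n choose i) * 2 ^ i / Gamma (\<alpha> + real i + 1)"
  have "has_bochner_integral half_line
     (\<lambda>t. \<Sum>i\<le>n. ?c i * (t powr \<alpha> * exp (- (2 * t)) * t ^ (i + j)))
     (\<Sum>i\<le>n. ?c i * (Gamma (\<alpha> + real (i + j) + 1) / 2 powr (\<alpha> + real (i + j) + 1)))"
    by (intro has_bochner_integral_sum has_bochner_integral_mult_right
        has_bochner_integral_Gamma_power \<alpha>) auto
  moreover have "(\<Sum>i\<le>n. ?c i * (t powr \<alpha> * exp (- (2 * t)) * t ^ (i + j)))
      = t powr \<alpha> * exp (- (2 * t)) * laguerre \<alpha> n t * t ^ j" for t
    by (simp add: laguerre_def sum_distrib_left sum_distrib_right power_add mult_ac)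
  moreover have "(\<Sum>i\<le>n. ?c i * (Gamma (\<alpha> + real (i + j) + 1) / 2 powr (\<alpha> + real (i + j) + 1)))
      = (if j = n then fact n else 0) / 2 powr (\<alpha> + real j + 1)"
  proof -
    have "?c i * (Gamma (\<alpha> + real (i + j) + 1) / 2 powr (\<alpha> + real (i + j) + 1))
        = (-1) ^ (n + i) * real (n choose i) * pochhammer (\<alpha> + 1 + real i) j / 2 powr (\<alpha> + real j + 1)" for i
    proof -
      have pos: "\<alpha> + real i + 1 > 0" using \<alpha> by linarith
      then have "pochhammer (\<alpha> + real i + 1) j = Gamma (\<alpha> + real i + 1 + real j) / Gamma (\<alpha> + real i + 1)"
        by (intro pochhammer_Gamma) auto
      moreover have "2 powr (\<alpha> + real (i + j) + 1) = 2 powr (\<alpha> + real j + 1) * (2::real) ^ i"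
        by (simp add: powr_add powr_realpow)
      ultimately show ?thesis using pos by (simp add: add_ac field_simps)
    qed
    then show ?thesis
      using alternating_binomial_sum_pochhammer[OF \<open>j \<le> n\<close>, of "\<alpha> + 1"]
      by (simp add: sum_divide_distrib [symmetric])
  qed
  ultimately show ?thesis by (simp only:)
qed

lemma laguerre_orthogonal:
  fixes \<alpha> :: real
  assumes \<alpha>: "\<alpha> > -1"
  shows "has_bochner_integral half_line (\<lambda>t. t powr \<alpha> * (exp (- t) * laguerre \<alpha> n t) * (exp (- t) * laguerre \<alpha> m t))
    (if n = m then laguerre_norm \<alpha> n else 0)"
proof (induction n m rule: linorder_wlog)
  case (sym a b)
  then show ?case by (simp add: mult_ac eq_commute[of b a] split: if_splits)
next
  case (le m n)
  \<comment> \<open>The polynomial of the lower degree m is expanded: all its powers below n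
    integrate to 0 against the other one, so a contribution exists only for m = n.\<close>
  let ?c = "\<lambda>i. (-1) ^ (m + i) * real (m choose i) * 2 ^ i / Gamma (\<alpha> + real i + 1)"
  have "has_bochner_integral half_line
     (\<lambda>t. \<Sum>i\<le>m. ?c i * (t powr \<alpha> * exp (- (2 * t)) * laguerre \<alpha> n t * t ^ i))
     (\<Sum>i\<le>m. ?c i * ((if i = n then fact n else 0) / 2 powr (\<alpha> + real i + 1)))"
    using le by (intro has_bochner_integral_sum has_bochner_integral_mult_right laguerre_power_integral \<alpha>) auto
  moreover have "(\<Sum>i\<le>m. ?c i * (t powr \<alpha> * exp (- (2 * t)) * laguerre \<alpha> n t * t ^ i))
      = t powr \<alpha> * (exp (- t) * laguerre \<alpha> m t) * (exp (- t) * laguerre \<alpha> n t)" for t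
  proof -
    have "exp (- (2 * t)) = exp (- t) * exp (- t)" by (simp flip: exp_add)
    then show ?thesis
      by (subst (2) laguerre_def) (simp add: sum_distrib_left mult_ac)
  qed
  moreover have "(\<Sum>i\<le>m. ?c i * ((if i = n then fact n else 0) / 2 powr (\<alpha> + real i + 1)))
      = (if m = n then laguerre_norm \<alpha> m else 0)"
  proof (cases "m = n")
    case True
    have "(\<Sum>i\<le>m. ?c i * ((if i = n then fact n else 0) / 2 powr (\<alpha> + real i + 1)))
        = (\<Sum>i\<le>m. if i = n then ?c n * fact n / 2 powr (\<alpha> + real n + 1) else 0)"
      by (intro sum.cong) auto
    also have "\<dots> = ?c n * fact n / 2 powr (\<alpha> + real n + 1)"
      using True by simp
    also have "\<dots> = laguerre_norm \<alpha> m"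
      using True by (simp add: laguerre_norm_def powr_add powr_realpow flip: mult_2)
    finally show ?thesis using True by simp
  next
    case False
    then show ?thesis using le by (auto intro!: sum.neutral)
  qed
  ultimately show ?case by (simp only:)
qed

lemma laguerre_norm_pos: "\<alpha> > -1 \<Longrightarrow> laguerre_norm \<alpha> n > 0"
  unfolding laguerre_norm_def by (intro divide_pos_pos mult_pos_pos Gamma_real_pos) auto

text \<open>The integral of w |f - sum (\<kappa> / h n) p_n a_n|^2 is nonnegative and equals the
  right side minus the left side. The coefficients of \<open>f\<close> are tested only against their
  own vectors \<open>a n\<close>, so scalar integrals suffice although \<open>f\<close> is
  vector-valued.\<close>

lemma Bessel_inequality_weighted:
  fixes f :: "real \<Rightarrow> 'b::real_inner" and a :: "nat \<Rightarrow> 'b"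
  assumes w: "\<And>t. w t \<ge> 0"
    and orth: "\<And>n m. n < N \<Longrightarrow> m < N \<Longrightarrow>
      has_bochner_integral M (\<lambda>t. w t * p n t * p m t) (if n = m then h n else 0)"
    and h: "\<And>n. n < N \<Longrightarrow> h n > 0"
    and f: "integrable M (\<lambda>t. w t * (norm (f t))\<^sup>2)"
    and coeff: "\<And>n. n < N \<Longrightarrow> has_bochner_integral M (\<lambda>t. w t * p n t * (f t \<bullet> a n)) (\<kappa> * (norm (a n))\<^sup>2)"
  shows "\<kappa>\<^sup>2 * (\<Sum>n<N. (norm (a n))\<^sup>2 / h n) \<le> (\<integral>t. w t * (norm (f t))\<^sup>2 \<partial>M)"
proof -
  let ?I = "\<integral>t. w t * (norm (f t))\<^sup>2 \<partial>M"
  \<comment> \<open>Tested against a n, the n-th coefficient of f looks like \<kappa> a n / h n;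
    this is the corresponding multiplier.\<close>
  define \<theta> where "\<theta> n = \<kappa> / h n" for n
  let ?u = "\<lambda>t. \<Sum>n<N. (\<theta> n * p n t) *\<^sub>R a n"
  have "has_bochner_integral M
      (\<lambda>t. w t * (norm (f t))\<^sup>2 - 2 * (\<Sum>n<N. \<theta> n * (w t * p n t * (f t \<bullet> a n)))
        + (\<Sum>n<N. \<Sum>m<N. \<theta> n * \<theta> m * (a n \<bullet> a m) * (w t * p n t * p m t)))
      (?I - 2 * (\<Sum>n<N. \<theta> n * (\<kappa> * (norm (a n))\<^sup>2))
        + (\<Sum>n<N. \<Sum>m<N. \<theta> n * \<theta> m * (a n \<bullet> a m) * (if n = m then h n else 0)))"
    using f orth coeff
    by (intro has_bochner_integral_add has_bochner_integral_diff has_bochner_integral_mult_right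
        has_bochner_integral_sum has_bochner_integral_integrable) auto
  moreover have "w t * (norm (f t))\<^sup>2 - 2 * (\<Sum>n<N. \<theta> n * (w t * p n t * (f t \<bullet> a n)))
        + (\<Sum>n<N. \<Sum>m<N. \<theta> n * \<theta> m * (a n \<bullet> a m) * (w t * p n t * p m t))
      = w t * (norm (f t - ?u t))\<^sup>2" for t
  proof -
    have e1: "(norm (f t - ?u t))\<^sup>2 = (norm (f t))\<^sup>2 - 2 * (f t \<bullet> ?u t) + ?u t \<bullet> ?u t"
      by (simp add: power2_norm_eq_inner inner_diff_left inner_diff_right inner_commute)
    have e2: "f t \<bullet> ?u t = (\<Sum>n<N. \<theta> n * p n t * (f t \<bullet> a n))"
      by (simp add: inner_sum_right)
    have e3: "?u t \<bullet> ?u t = (\<Sum>n<N. \<Sum>m<N. (\<theta> n * p n t) * ((\<theta> m * p m t) * (a n \<bullet> a m)))"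
      unfolding inner_sum_left
      by (intro sum.cong refl) (simp add: inner_sum_right sum_distrib_left mult_ac)
    have e4: "(\<Sum>n<N. \<theta> n * (w t * p n t * (f t \<bullet> a n)))
        = w t * (\<Sum>n<N. \<theta> n * p n t * (f t \<bullet> a n))"
      by (simp add: sum_distrib_left mult_ac)
    have e5: "(\<Sum>n<N. \<Sum>m<N. \<theta> n * \<theta> m * (a n \<bullet> a m) * (w t * p n t * p m t))
        = w t * (\<Sum>n<N. \<Sum>m<N. (\<theta> n * p n t) * ((\<theta> m * p m t) * (a n \<bullet> a m)))"
      by (simp add: sum_distrib_left mult_ac)
    show ?thesis
      unfolding e1 e2 e3 e4 e5 by (simp only: ring_distribs mult.left_commute)
  qed
  ultimately have "has_bochner_integral M (\<lambda>t. w t * (norm (f t - ?u t))\<^sup>2)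
      (?I - 2 * (\<Sum>n<N. \<theta> n * (\<kappa> * (norm (a n))\<^sup>2))
        + (\<Sum>n<N. \<Sum>m<N. \<theta> n * \<theta> m * (a n \<bullet> a m) * (if n = m then h n else 0)))"
    by (simp only:)
  then have "0 \<le> ?I - 2 * (\<Sum>n<N. \<theta> n * (\<kappa> * (norm (a n))\<^sup>2))
        + (\<Sum>n<N. \<Sum>m<N. \<theta> n * \<theta> m * (a n \<bullet> a m) * (if n = m then h n else 0))"
    by (rule subst[OF has_bochner_integral_integral_eq]) (use w in auto)
  also have "(\<Sum>n<N. \<Sum>m<N. \<theta> n * \<theta> m * (a n \<bullet> a m) * (if n = m then h n else 0))
      = (\<Sum>n<N. \<theta> n * \<theta> n * (a n \<bullet> a n) * h n)"
    by (intro sum.cong refl) (simp add: if_distrib cong: if_cong)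
  also have "\<dots> = (\<Sum>n<N. \<theta> n * (\<kappa> * (norm (a n))\<^sup>2))"
    using h by (intro sum.cong refl) (auto simp: \<theta>_def power2_norm_eq_inner field_simps dest: less_imp_neq)
  also have "\<dots> = \<kappa>\<^sup>2 * (\<Sum>n<N. (norm (a n))\<^sup>2 / h n)"
    by (simp add: \<theta>_def sum_distrib_left power2_eq_square mult.assoc)
  finally show ?thesis by simp
qed

text \<open>Raising n by one multiplies the left side by (1 + 1/(1+n))^\<alpha> and the right side
  by 1 + \<alpha>/(1+n), and Bernoulli's inequality for exponents in (0,1) compares the two.\<close>

lemma powr_le_Gamma_quotient:
  fixes \<alpha> :: real
  assumes "0 < \<alpha>" "\<alpha> < 1"
  shows "(1 + real n) powr \<alpha> * Gamma (\<alpha> + 1) \<le> Gamma (\<alpha> + real n + 1) / fact n"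
proof (induction n)
  case 0
  then show ?case by simp
next
  case (Suc n)
  have "0 < 1 + 1 / (1 + real n)"
    by (intro add_pos_pos) auto
  \<comment> \<open>Young's inequality with weights \<alpha> and 1 - \<alpha> and second factor 1 is
    Bernoulli's inequality.\<close>
  then have step: "(1 + 1 / (1 + real n)) powr \<alpha> \<le> 1 + \<alpha> / (1 + real n)"
    using Youngs_inequality_0[of \<alpha> "1 - \<alpha>" "1 + 1 / (1 + real n)" 1] assms
    by (simp add: algebra_simps)
  have "(1 + real (Suc n)) powr \<alpha> = (1 + real n) powr \<alpha> * (1 + 1 / (1 + real n)) powr \<alpha>"
    by (subst powr_mult [symmetric]) (simp_all add: distrib_left)
  then have "(1 + real (Suc n)) powr \<alpha> * Gamma (\<alpha> + 1)
      = ((1 + real n) powr \<alpha> * Gamma (\<alpha> + 1)) * (1 + 1 / (1 + real n)) powr \<alpha>" by simp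
  also have "\<dots> \<le> (Gamma (\<alpha> + real n + 1) / fact n) * (1 + \<alpha> / (1 + real n))"
    using Suc.IH step assms by (intro mult_mono) (auto intro!: Gamma_real_nonneg divide_nonneg_nonneg)
  also have "\<dots> = Gamma (\<alpha> + real (Suc n) + 1) / fact (Suc n)"
  proof -
    have "\<alpha> + real (Suc n) + 1 = (\<alpha> + real n + 1) + 1" by simp
    moreover have "Gamma ((\<alpha> + real n + 1) + 1) = (\<alpha> + real n + 1) * Gamma (\<alpha> + real n + 1)"
      using assms by (intro Gamma_real_plus1) auto
    ultimately have "Gamma (\<alpha> + real (Suc n) + 1) = (\<alpha> + real n + 1) * Gamma (\<alpha> + real n + 1)"
      by (simp only:)
    then show ?thesis
      by (simp add: divide_simps)
  qed
  finally show ?case .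
qed

section \<open>Weak integrals in Hilbert spaces\<close>

instance chilbert_space \<subseteq> banach ..

section \<open>Complex scalars and the real inner product\<close>

lemma scaleC_one [simp]: "1 *\<^sub>C x = (x::'a::complex_inner)"
  using scaleC_of_real[of 1 x] by simp

lemma scaleC_zero_left [simp]: "0 *\<^sub>C x = (0::'a::complex_inner)"
  using scaleC_of_real[of 0 x] by simp

lemma scaleC_scaleR: "c *\<^sub>C (r *\<^sub>R x) = r *\<^sub>R (c *\<^sub>C (x::'a::complex_inner))"
  by (simp add: scaleC_of_real [symmetric] scaleC_scaleC mult.commute)

lemma scaleC_minus_left: "(- c) *\<^sub>C x = - (c *\<^sub>C (x::'a::complex_inner))"
  using scaleC_add_left[of "- c" c x] by (simp add: eq_neg_iff_add_eq_0)

lemma scaleC_diff_left: "(c - d) *\<^sub>C x = c *\<^sub>C x - d *\<^sub>C (x::'a::complex_inner)"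
  using scaleC_add_left[of c "- d" x] by (simp add: scaleC_minus_left)

lemma scaleC_diff_right: "c *\<^sub>C (x - y) = c *\<^sub>C x - c *\<^sub>C (y::'a::complex_inner)"
  using scaleC_add_right[of c "x - y" y] by simp

lemma inner_scaleC: "(c *\<^sub>C x) \<bullet> y = x \<bullet> (cnj c *\<^sub>C (y::'a::complex_inner))"
proof -
  have "cinner x (cnj c *\<^sub>C y) = cnj (cnj c * cinner y x)"
    by (subst cinner_commute) (simp add: cinner_scaleC_left)
  also have "\<dots> = c * cinner x y"
    by (subst cinner_commute[of x y]) simp
  finally show ?thesis
    by (simp add: Re_cinner [symmetric] cinner_scaleC_left)
qed

lemma norm_scaleC: "norm (c *\<^sub>C x) = cmod c * norm (x::'a::complex_inner)"
proof -
  have "(norm (c *\<^sub>C x))\<^sup>2 = x \<bullet> ((cnj c * c) *\<^sub>C x)"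
    by (simp add: power2_norm_eq_inner inner_scaleC scaleC_scaleC)
  also have "cnj c * c = complex_of_real ((cmod c)\<^sup>2)"
    by (metis complex_norm_square mult.commute)
  finally have "(norm (c *\<^sub>C x))\<^sup>2 = (cmod c * norm x)\<^sup>2"
    by (simp add: scaleC_of_real power2_norm_eq_inner power_mult_distrib)
  then show ?thesis by (simp add: power2_eq_iff_nonneg)
qed

lemma bounded_linear_scaleC: "bounded_linear (\<lambda>x. c *\<^sub>C (x::'a::complex_inner))"
  by (rule bounded_linear_intro[where K = "cmod c"])
    (simp_all add: scaleC_add_right scaleC_scaleR norm_scaleC mult.commute)

text \<open>Continuity only on the open half line admits an integrable singularity at 0, such as
  s^(\<alpha>-1) in Balakrishnan's formula. The majorant stays explicit because the norm estimates
  integrate it.\<close>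

definition dominated :: "(real \<Rightarrow> 'a::real_normed_vector) \<Rightarrow> (real \<Rightarrow> real) \<Rightarrow> bool"
  where "dominated g b \<longleftrightarrow> continuous_on {0<..} g \<and> integrable half_line b \<and> (\<forall>s>0. norm (g s) \<le> b s)"

lemma dominated_compose:
  assumes "dominated g b" "bounded_linear L"
  shows "dominated (\<lambda>s. L (g s)) (\<lambda>s. onorm L * b s)"
  unfolding dominated_def
proof (intro conjI allI impI)
  show "continuous_on {0<..} (\<lambda>s. L (g s))"
    using assms(1) by (intro bounded_linear.continuous_on[OF assms(2)]) (simp add: dominated_def)
  show "integrable half_line (\<lambda>s. onorm L * b s)"
    using assms by (auto simp: dominated_def)
  fix s :: real assume "s > 0"
  then have "norm (g s) \<le> b s" using assms by (auto simp: dominated_def)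
  then show "norm (L (g s)) \<le> onorm L * b s"
    by (meson assms(2) mult_left_mono onorm onorm_pos_le order_trans)
qed

lemma dominated_integrable:
  fixes g :: "real \<Rightarrow> real"
  assumes "dominated g b"
  shows "integrable half_line g"
proof (rule Bochner_Integration.integrable_bound)
  show "integrable half_line b" "g \<in> borel_measurable half_line"
    using assms by (auto simp: dominated_def intro: measurable_half_line_continuous)
  show "AE s in half_line. norm (g s) \<le> norm (b s)"
    using assms by (intro AE_I2) (force simp: dominated_def)
qed

lemma integral_half_line_exhaustion:
  fixes f :: "real \<Rightarrow> real"
  assumes f: "integrable half_line f"
  shows "(\<lambda>n. \<integral>s. indicator {1 / real (Suc n)..real (Suc n)} s * f s \<partial>half_line)
    \<longlonglongrightarrow> (\<integral>s. f s \<partial>half_line)"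
proof (rule integral_dominated_convergence[where w = "\<lambda>s. \<bar>f s\<bar>"])
  have "(\<lambda>n. indicator {1 / real (Suc n)..real (Suc n)} s * f s) \<longlonglongrightarrow> f s" if "s > 0" for s
  proof (rule tendsto_eventually)
    obtain N :: nat where N: "real N > s" "real N > 1 / s"
      using reals_Archimedean2[of "max s (1 / s)"] by auto
    have "indicator {1 / real (Suc n)..real (Suc n)} s * f s = f s" if "n \<ge> N" for n
    proof -
      have "real (Suc n) > s" "real (Suc n) > 1 / s" using N that by auto
      then show ?thesis using \<open>s > 0\<close> by (auto simp: indicator_def field_simps)
    qed
    then show "\<forall>\<^sub>F n in sequentially. indicator {1 / real (Suc n)..real (Suc n)} s * f s = f s"
      by (auto simp: eventually_sequentially)
  qed
  then show "AE s in half_line. (\<lambda>n. indicator {1 / real (Suc n)..real (Suc n)} s * f s) \<longlonglongrightarrow> f s"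
    by (intro AE_I2) auto
qed (use f in \<open>auto intro!: AE_I2 borel_measurable_times simp: indicator_def borel_measurable_integrable\<close>)

text \<open>On the compact intervals [1/(n+1), n+1] a continuous function with values in a Banach
  space has a gauge integral. The differences of these integrals are bounded by those of the
  integrals of \<open>b\<close>, so they form a Cauchy sequence, and every functional passes to the
  limit by dominated convergence.\<close>

lemma ex_weak_integral:
  fixes g :: "real \<Rightarrow> 'a::{real_inner, banach}"
  assumes g: "dominated g b"
  shows "\<exists>v. \<forall>\<phi>::'a \<Rightarrow> real. bounded_linear \<phi> \<longrightarrow> \<phi> v = (\<integral>s. \<phi> (g s) \<partial>half_line)"
proof -
  define I where "I n = {1 / real (Suc n)..real (Suc n)}" for n
  define v where "v n = integral (I n) g" for n
  define \<beta> where "\<beta> n = (\<integral>s. indicator (I n) s * b s \<partial>half_line)" for n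
  have pos: "s > 0" if "s \<in> I n" for s n
  proof -
    have "0 < 1 / real (Suc n)" by simp
    then show ?thesis using that unfolding I_def atLeastAtMost_iff by linarith
  qed
  have cont: "continuous_on (I n) g" for n
    using g pos by (auto simp: dominated_def intro: continuous_on_subset)
  have b: "integrable half_line b" using g by (simp add: dominated_def)
  have "I n \<in> sets half_line" for n
    using pos[of _ n] unfolding sets_restrict_space
    by (intro image_eqI[of _ _ "I n"]) (auto simp: I_def)
  then have b_ind: "integrable half_line (\<lambda>s. indicator (I n) s * b s)" for n
    using integrable_real_mult_indicator[OF _ b, of "I n"] by (simp add: mult.commute)
  have \<phi>_v: "\<phi> (v n) = (\<integral>s. indicator (I n) s * \<phi> (g s) \<partial>half_line)"
    and \<phi>_int: "integrable half_line (\<lambda>s. indicator (I n) s * \<phi> (g s))"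
    if \<phi>: "bounded_linear \<phi>" for \<phi> :: "'a \<Rightarrow> real" and n
  proof -
    have cont': "continuous_on (I n) (\<lambda>s. \<phi> (g s))"
      by (rule bounded_linear.continuous_on[OF \<phi> cont])
    then have si: "set_integrable lborel (I n) (\<lambda>s. \<phi> (g s))"
      unfolding I_def by (rule borel_integrable_atLeastAtMost')
    have restr: "indicator {0<..} s * (indicator (I n) s * x) = indicator (I n) s * x" for s x :: real
      using pos by (auto simp: indicator_def)
    have "\<phi> (v n) = integral (I n) (\<lambda>s. \<phi> (g s))"
      unfolding v_def using integral_linear[OF _ \<phi>, of g "I n"] cont[of n]
      by (simp add: o_def I_def integrable_continuous_interval)
    also have "\<dots> = (LINT s:I n|lborel. \<phi> (g s))"
      using set_borel_integral_eq_integral(2)[OF si] by simp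
    also have "\<dots> = (\<integral>s. indicator (I n) s * \<phi> (g s) \<partial>half_line)"
      by (simp add: integral_restrict_space restr set_lebesgue_integral_def)
    finally show "\<phi> (v n) = (\<integral>s. indicator (I n) s * \<phi> (g s) \<partial>half_line)" .
    show "integrable half_line (\<lambda>s. indicator (I n) s * \<phi> (g s))"
      using si by (simp add: integrable_restrict_space restr set_integrable_def)
  qed
  have diff: "norm (v n - v m) \<le> \<beta> n - \<beta> m" if "m \<le> n" for m n
  proof -
    \<comment> \<open>Pairing the difference with itself reduces the bound of its norm to a
      comparison of scalar integrals.\<close>
    define d where "d = v n - v m"
    have sub: "I m \<subseteq> I n"
    proof -
      have "1 / real (Suc n) \<le> 1 / real (Suc m)" using that by (intro divide_left_mono) auto
      then show ?thesis using that by (auto simp: I_def)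
    qed
    have bl: "bounded_linear (\<lambda>x. x \<bullet> d)" by (rule bounded_linear_inner_left)
    have "d \<bullet> d = v n \<bullet> d - v m \<bullet> d" by (simp add: d_def inner_diff_left)
    also have "\<dots> = (\<integral>s. indicator (I n) s * (g s \<bullet> d) - indicator (I m) s * (g s \<bullet> d) \<partial>half_line)"
      using \<phi>_v[OF bl] \<phi>_int[OF bl] by simp
    also have "\<dots> \<le> (\<integral>s. norm d * (indicator (I n) s * b s - indicator (I m) s * b s) \<partial>half_line)"
    proof (intro integral_mono)
      fix s :: real assume "s \<in> space half_line"
      then have "norm (g s) \<le> b s" using g by (auto simp: dominated_def)
      then have "g s \<bullet> d \<le> norm d * b s"
        by (metis mult.commute mult_right_mono norm_cauchy_schwarz norm_ge_zero order_trans)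
      then show "indicator (I n) s * (g s \<bullet> d) - indicator (I m) s * (g s \<bullet> d)
          \<le> norm d * (indicator (I n) s * b s - indicator (I m) s * b s)"
        using sub by (auto simp: indicator_def)
    qed (use \<phi>_int[OF bl] b_ind in auto)
    also have "\<dots> = norm d * (\<beta> n - \<beta> m)"
      using b_ind by (simp add: \<beta>_def)
    finally have "norm d * norm d \<le> norm d * (\<beta> n - \<beta> m)"
      by (simp add: power2_norm_eq_inner [symmetric] power2_eq_square)
    moreover have "\<beta> m \<le> \<beta> n"
      unfolding \<beta>_def
    proof (intro integral_mono b_ind)
      fix s :: real assume "s \<in> space half_line"
      then have "0 \<le> b s" using g by (auto simp: dominated_def intro: order_trans[OF norm_ge_zero])
      then show "indicator (I m) s * b s \<le> indicator (I n) s * b s"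
        using sub by (auto simp: indicator_def)
    qed
    ultimately have "norm d \<le> \<beta> n - \<beta> m"
      by (cases "norm d = 0") (auto simp: mult_le_cancel_left_pos)
    then show ?thesis by (simp add: d_def)
  qed
  have "\<beta> \<longlonglongrightarrow> (\<integral>s. b s \<partial>half_line)"
    unfolding \<beta>_def I_def by (rule integral_half_line_exhaustion[OF b])
  then have "Cauchy \<beta>" by (rule LIMSEQ_imp_Cauchy)
  have "Cauchy v"
  proof (rule CauchyI')
    fix e :: real assume "e > 0"
    then obtain M where M: "\<And>m n. m \<ge> M \<Longrightarrow> n \<ge> M \<Longrightarrow> dist (\<beta> m) (\<beta> n) < e"
      using \<open>Cauchy \<beta>\<close> by (meson metric_CauchyD)
    have *: "norm (v m - v n) < e" if "m \<ge> M" "n > m" for m n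
    proof -
      have "norm (v n - v m) \<le> \<beta> n - \<beta> m" using diff that by auto
      also have "\<dots> \<le> dist (\<beta> m) (\<beta> n)" by (simp add: dist_real_def)
      also have "\<dots> < e" using M that by auto
      finally show ?thesis by (simp add: norm_minus_commute)
    qed
    show "\<exists>M. \<forall>m\<ge>M. \<forall>n>m. dist (v m) (v n) < e" using * by (auto simp: dist_norm)
  qed
  then obtain w where w: "v \<longlonglongrightarrow> w" by (auto simp: Cauchy_convergent_iff convergent_def)
  have "\<phi> w = (\<integral>s. \<phi> (g s) \<partial>half_line)" if \<phi>: "bounded_linear \<phi>" for \<phi> :: "'a \<Rightarrow> real"
  proof (rule LIMSEQ_unique)
    show "(\<lambda>n. \<phi> (v n)) \<longlonglongrightarrow> \<phi> w" using \<phi> w by (rule bounded_linear.tendsto)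
    show "(\<lambda>n. \<phi> (v n)) \<longlonglongrightarrow> (\<integral>s. \<phi> (g s) \<partial>half_line)"
      unfolding \<phi>_v[OF \<phi>] unfolding I_def
      by (intro integral_half_line_exhaustion dominated_integrable[OF dominated_compose[OF g \<phi>]])
  qed
  then show ?thesis by blast
qed

text \<open>The Bochner integral of the library requires a second countable codomain.\<close>

definition weak_integral :: "(real \<Rightarrow> 'a::{real_inner, banach}) \<Rightarrow> 'a"
  where "weak_integral g =
    (SOME v. \<forall>\<phi>::'a \<Rightarrow> real. bounded_linear \<phi> \<longrightarrow> \<phi> v = (\<integral>s. \<phi> (g s) \<partial>half_line))"

lemma weak_integral_cong:
  fixes f h :: "real \<Rightarrow> 'a::{real_inner, banach}"
  assumes "\<And>s. s > 0 \<Longrightarrow> f s = h s"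
  shows "weak_integral f = weak_integral h"
proof -
  have "(\<integral>s. \<phi> (f s) \<partial>half_line) = (\<integral>s. \<phi> (h s) \<partial>half_line)" for \<phi> :: "'a \<Rightarrow> real"
    using assms by (intro Bochner_Integration.integral_cong) auto
  then show ?thesis by (simp add: weak_integral_def)
qed

lemma weak_integral_functional:
  fixes g :: "real \<Rightarrow> 'a::{real_inner, banach}" and \<phi> :: "'a \<Rightarrow> real"
  assumes "dominated g b" "bounded_linear \<phi>"
  shows "\<phi> (weak_integral g) = (\<integral>s. \<phi> (g s) \<partial>half_line)"
  using someI_ex[OF ex_weak_integral[OF assms(1)]] assms(2) unfolding weak_integral_def by blast

lemma weak_integral_inner:
  fixes g :: "real \<Rightarrow> 'a::{real_inner, banach}"
  assumes "dominated g b"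
  shows "weak_integral g \<bullet> y = (\<integral>s. g s \<bullet> y \<partial>half_line)"
  using weak_integral_functional[OF assms bounded_linear_inner_left] .

text \<open>Pairing the integral v with itself bounds |v|^2 by |v| times the integral of
  \<open>b\<close>.\<close>

lemma norm_weak_integral_le:
  fixes g :: "real \<Rightarrow> 'a::{real_inner, banach}"
  assumes g: "dominated g b"
  shows "norm (weak_integral g) \<le> (\<integral>s. b s \<partial>half_line)"
proof -
  let ?v = "weak_integral g"
  have b: "integrable half_line b" "\<And>s. s > 0 \<Longrightarrow> norm (g s) \<le> b s"
    using g by (auto simp: dominated_def)
  have "norm ?v * norm ?v = (\<integral>s. g s \<bullet> ?v \<partial>half_line)"
    using weak_integral_inner[OF g, of ?v] by (simp add: power2_norm_eq_inner [symmetric] power2_eq_square)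
  also have "\<dots> \<le> (\<integral>s. norm ?v * b s \<partial>half_line)"
  proof (intro integral_mono)
    show "integrable half_line (\<lambda>s. g s \<bullet> ?v)"
      by (intro dominated_integrable[OF dominated_compose[OF g]] bounded_linear_inner_left)
    fix s :: real assume "s \<in> space half_line"
    then show "g s \<bullet> ?v \<le> norm ?v * b s"
      using b(2)[of s] by (metis greaterThan_iff mult.commute mult_right_mono norm_cauchy_schwarz norm_ge_zero order_trans space_half_line)
  qed (use b in auto)
  also have "\<dots> = norm ?v * (\<integral>s. b s \<partial>half_line)" by simp
  finally have "norm ?v * norm ?v \<le> norm ?v * (\<integral>s. b s \<partial>half_line)" .
  moreover have "0 \<le> (\<integral>s. b s \<partial>half_line)"
    using b(2) by (intro integral_nonneg_AE AE_I2) (auto intro: order_trans[OF norm_ge_zero])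
  ultimately show ?thesis
    by (cases "norm ?v = 0") (auto simp: mult_le_cancel_left_pos)
qed

lemma weak_integral_eqI:
  fixes g :: "real \<Rightarrow> 'a::{real_inner, banach}"
  assumes "dominated g b" and "\<And>y. v \<bullet> y = (\<integral>s. g s \<bullet> y \<partial>half_line)"
  shows "weak_integral g = v"
  using weak_integral_inner[OF assms(1)] assms(2)
  by (intro vector_eq_rdot[THEN iffD1]) (simp add: inner_commute)

lemma weak_integral_linear:
  fixes g :: "real \<Rightarrow> 'a::{real_inner, banach}" and L :: "'a \<Rightarrow> 'b::{real_inner, banach}"
  assumes g: "dominated g b" and L: "bounded_linear L"
  shows "L (weak_integral g) = weak_integral (\<lambda>s. L (g s))"
proof (rule weak_integral_eqI[OF dominated_compose[OF g L], symmetric])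
  fix y
  show "L (weak_integral g) \<bullet> y = (\<integral>s. L (g s) \<bullet> y \<partial>half_line)"
    using bounded_linear_compose[OF bounded_linear_inner_left L]
    by (intro weak_integral_functional[OF g])
qed

lemma weak_integral_add:
  fixes f g :: "real \<Rightarrow> 'a::{real_inner, banach}"
  assumes f: "dominated f b" and g: "dominated g c"
  shows "weak_integral (\<lambda>s. f s + g s) = weak_integral f + weak_integral g"
proof (rule weak_integral_eqI)
  show "dominated (\<lambda>s. f s + g s) (\<lambda>s. b s + c s)"
    using f g unfolding dominated_def
    by (auto intro!: continuous_on_add norm_triangle_mono)
  fix y
  show "(weak_integral f + weak_integral g) \<bullet> y = (\<integral>s. (f s + g s) \<bullet> y \<partial>half_line)"
    using dominated_integrable[OF dominated_compose[OF f bounded_linear_inner_left[of y]]]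
      dominated_integrable[OF dominated_compose[OF g bounded_linear_inner_left[of y]]]
    by (simp add: inner_add_left weak_integral_inner[OF f] weak_integral_inner[OF g])
qed

section \<open>Contraction semigroups\<close>

lemma has_bochner_integral_exp:
  fixes c :: real
  assumes "c > 0"
  shows "has_bochner_integral half_line (\<lambda>t. exp (- (c * t))) (1 / c)"
proof -
  have "has_bochner_integral half_line (\<lambda>t. t powr 0 * exp (- (c * t)) * t ^ 0)
      (Gamma (0 + real 0 + 1) / c powr (0 + real 0 + 1))"
    using assms by (intro has_bochner_integral_Gamma_power) auto
  then show ?thesis
    by (rule iffD1[OF has_bochner_integral_cong, rotated -1]) (use assms in auto)
qed

locale contraction_semigroup =
  fixes S :: "real \<Rightarrow> 'a::chilbert_space \<Rightarrow> 'a"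
  assumes contractive: "contractive_C0_semigroup S"
begin

lemma S_linear: "t \<ge> 0 \<Longrightarrow> bounded_linear (S t)"
  and S_scaleC: "t \<ge> 0 \<Longrightarrow> S t (c *\<^sub>C x) = c *\<^sub>C S t x"
  and S_zero [simp]: "S 0 x = x"
  and S_add: "s \<ge> 0 \<Longrightarrow> t \<ge> 0 \<Longrightarrow> S (s + t) x = S s (S t x)"
  and S_tendsto: "((\<lambda>t. S t x) \<longlongrightarrow> x) (at_right 0)"
  using contractive
  by (auto simp: contractive_C0_semigroup_def C0_semigroup_def bounded_clinear_def)

lemma norm_S_le: "t \<ge> 0 \<Longrightarrow> norm (S t x) \<le> norm x"
  using onorm[OF S_linear, of t x] contractive mult_right_mono[of "onorm (S t)" 1 "norm x"]
  by (auto simp: contractive_C0_semigroup_def)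

lemma S_diff: "t \<ge> 0 \<Longrightarrow> S t (x - y) = S t x - S t y"
  by (simp add: S_linear linear_diff bounded_linear.linear)

lemma S_scaleR: "t \<ge> 0 \<Longrightarrow> S t (r *\<^sub>R x) = r *\<^sub>R S t x"
  by (simp add: S_linear linear_scale bounded_linear.linear)

lemma S_near_identity:
  assumes "e > 0"
  obtains d where "d > 0" "\<And>t. 0 \<le> t \<Longrightarrow> t < d \<Longrightarrow> norm (S t x - x) < e"
proof -
  have "\<forall>\<^sub>F t in at_right 0. dist (S t x) x < e"
    using S_tendsto assms by (rule tendstoD)
  then obtain d where "d > 0" "\<And>t. 0 < t \<Longrightarrow> t < d \<Longrightarrow> dist (S t x) x < e"
    by (auto simp: eventually_at_right_field)
  then have "norm (S t x - x) < e" if "0 \<le> t" "t < d" for t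
    using that assms by (cases "t = 0") (auto simp: dist_norm)
  then show ?thesis using \<open>d > 0\<close> that by blast
qed

lemma norm_S_diff_le:
  assumes "s \<ge> 0" "t \<ge> 0"
  shows "norm (S t x - S s x) \<le> norm (S \<bar>t - s\<bar> x - x)"
proof -
  have *: "norm (S t x - S s x) \<le> norm (S (t - s) x - x)" if "0 \<le> s" "s \<le> t" for s t
  proof -
    have "S t x = S s (S (t - s) x)" using S_add[of s "t - s" x] that by simp
    then have "S t x - S s x = S s (S (t - s) x - x)" using that by (simp add: S_diff)
    then show ?thesis using norm_S_le[of s] that by simp
  qed
  show ?thesis
  proof (cases "s \<le> t")
    case True
    then show ?thesis using *[of s t] assms by simp
  next
    case False
    then show ?thesis using *[of t s] assms by (simp add: norm_minus_commute)
  qed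
qed

lemma continuous_on_S: "continuous_on {0..} (\<lambda>t. S t x)"
  unfolding continuous_on_iff
proof (intro ballI allI impI)
  fix s e :: real assume "s \<in> {0..}" "e > 0"
  then obtain d where "d > 0" and d: "\<And>t. 0 \<le> t \<Longrightarrow> t < d \<Longrightarrow> norm (S t x - x) < e"
    using S_near_identity by blast
  have "dist (S t x) (S s x) < e" if "t \<in> {0..}" "dist t s < d" for t
    using norm_S_diff_le[of s t x] d[of "\<bar>t - s\<bar>"] that \<open>s \<in> {0..}\<close> by (auto simp: dist_norm)
  then show "\<exists>d>0. \<forall>t\<in>{0..}. dist t s < d \<longrightarrow> dist (S t x) (S s x) < e"
    using \<open>d > 0\<close> by blast
qed

section \<open>The generator and its resolvent at positive reals\<close>

abbreviation "DA \<equiv> generator_dom S"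
abbreviation "A \<equiv> generator S"

lemma generator_tendsto:
  "x \<in> DA \<Longrightarrow> ((\<lambda>h. (S h x - x) /\<^sub>R h) \<longlongrightarrow> A x) (at_right 0)"
  unfolding generator_dom_def generator_def by (auto simp: tendsto_Lim)

lemma generatorI:
  assumes "((\<lambda>h. (S h x - x) /\<^sub>R h) \<longlongrightarrow> y) (at_right 0)"
  shows "x \<in> DA" "A x = y"
  using assms tendsto_Lim[OF _ assms] by (auto simp: generator_dom_def generator_def)

lemma generator_diff:
  assumes "x \<in> DA" "y \<in> DA"
  shows "x - y \<in> DA" "A (x - y) = A x - A y"
proof -
  have "((\<lambda>h. (S h x - x) /\<^sub>R h - (S h y - y) /\<^sub>R h) \<longlongrightarrow> A x - A y) (at_right 0)"
    using assms by (intro tendsto_diff generator_tendsto)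
  moreover have "\<forall>\<^sub>F h in at_right 0. (S h x - x) /\<^sub>R h - (S h y - y) /\<^sub>R h = (S h (x - y) - (x - y)) /\<^sub>R h"
    by (intro eventually_mono[OF eventually_at_right_less[of 0]])
      (simp add: S_diff algebra_simps flip: scaleR_diff_right)
  ultimately have "((\<lambda>h. (S h (x - y) - (x - y)) /\<^sub>R h) \<longlongrightarrow> A x - A y) (at_right 0)"
    by (rule Lim_transform_eventually)
  from generatorI[OF this] show "x - y \<in> DA" "A (x - y) = A x - A y" .
qed

text \<open>By contractivity S h x - x has a nonpositive real inner product with x, and this
  survives division by h and the limit. It yields the injectivity of \<lambda> - A for Re \<lambda>
  > 0, on which the meaning of \<open>inv_into\<close> in \<open>resolvent\<close> depends.\<close>

lemma generator_dissipative:
  assumes "x \<in> DA"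
  shows "A x \<bullet> x \<le> 0"
proof (rule tendsto_upperbound)
  show "((\<lambda>h. ((S h x - x) /\<^sub>R h) \<bullet> x) \<longlongrightarrow> A x \<bullet> x) (at_right 0)"
    by (intro tendsto_inner generator_tendsto assms tendsto_const)
  have "((S h x - x) /\<^sub>R h) \<bullet> x \<le> 0" if "h > 0" for h
  proof -
    have "S h x \<bullet> x \<le> norm x * norm x"
      using norm_cauchy_schwarz[of "S h x" x] norm_S_le[of h x] that
      by (meson less_imp_le mult_right_mono norm_ge_zero order_trans)
    then show ?thesis
      using that by (auto simp: inner_diff_left power2_norm_eq_inner [symmetric] power2_eq_square
          mult_le_0_iff)
  qed
  then show "\<forall>\<^sub>F h in at_right 0. ((S h x - x) /\<^sub>R h) \<bullet> x \<le> 0"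
    by (intro eventually_mono[OF eventually_at_right_less[of 0]])
qed simp

text \<open>An element w of the kernel of l - A satisfies Re l |w|^2 = A w \<bullet> w \<le> 0 and
  so vanishes. Hence a value of the resolvent is found by exhibiting a preimage.\<close>

lemma resolvent_eqI:
  assumes l: "Re l > 0" and x: "x \<in> DA" and eq: "l *\<^sub>C x - A x = y"
  shows "resolvent DA A l y = x"
  unfolding resolvent_def
proof (rule inv_into_f_eq)
  show "inj_on (\<lambda>x. l *\<^sub>C x - A x) DA"
  proof (rule inj_onI)
    fix u v assume uv: "u \<in> DA" "v \<in> DA" "l *\<^sub>C u - A u = l *\<^sub>C v - A v"
    define w where "w = u - v"
    have "A u - A v = l *\<^sub>C u - l *\<^sub>C v" using uv(3) by (simp add: algebra_simps)
    then have w: "w \<in> DA" "A w = l *\<^sub>C w"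
      using generator_diff[OF uv(1,2)] by (auto simp: w_def scaleC_diff_right)
    have "A w \<bullet> w = Re l * (norm w)\<^sup>2"
      unfolding w(2) by (simp add: Re_cinner [symmetric] cinner_scaleC_left cinner_self)
    then have "(norm w)\<^sup>2 \<le> 0"
      using generator_dissipative[OF w(1)] l by (simp add: mult_le_0_iff)
    then show "u = v" by (simp add: w_def)
  qed
qed (use assms in auto)

text \<open>The Laplace transform of the semigroup, which is the resolvent at \<mu> > 0. Real \<mu>
  are enough: at complex points the resolvent is obtained from T by the Cayley transform.\<close>

definition J :: "real \<Rightarrow> 'a \<Rightarrow> 'a"
  where "J \<mu> x = weak_integral (\<lambda>t. exp (- (\<mu> * t)) *\<^sub>R S t x)"

lemma dominated_Laplace:
  assumes "\<mu> > 0"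
  shows "dominated (\<lambda>t. exp (- (\<mu> * t)) *\<^sub>R S t x) (\<lambda>t. exp (- (\<mu> * t)) * norm x)"
  unfolding dominated_def
proof (intro conjI allI impI)
  show "continuous_on {0<..} (\<lambda>t. exp (- (\<mu> * t)) *\<^sub>R S t x)"
    by (intro continuous_intros continuous_on_subset[OF continuous_on_S]) auto
  show "integrable half_line (\<lambda>t. exp (- (\<mu> * t)) * norm x)"
    using has_bochner_integral_exp[OF assms] by (auto simp: has_bochner_integral_iff)
qed (simp add: norm_S_le)

lemma J_functional:
  fixes \<phi> :: "'a \<Rightarrow> real"
  assumes "\<mu> > 0" "bounded_linear \<phi>"
  shows "\<phi> (J \<mu> x) = (\<integral>t. exp (- (\<mu> * t)) * \<phi> (S t x) \<partial>half_line)"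
  unfolding J_def weak_integral_functional[OF dominated_Laplace[OF assms(1)] assms(2)]
  by (simp add: linear_scale[OF bounded_linear.linear[OF assms(2)]])

lemma integrable_Laplace:
  fixes \<phi> :: "'a \<Rightarrow> real"
  assumes "\<mu> > 0" "bounded_linear \<phi>"
  shows "integrable half_line (\<lambda>t. exp (- (\<mu> * t)) * \<phi> (S t x))"
  using dominated_integrable[OF dominated_compose[OF dominated_Laplace[OF assms(1)] assms(2)]]
  by (simp add: linear_scale[OF bounded_linear.linear[OF assms(2)]])

lemma S_J:
  assumes "\<mu> > 0" "h \<ge> 0"
  shows "S h (J \<mu> x) = J \<mu> (S h x)"
proof -
  have "S h (J \<mu> x) \<bullet> y = J \<mu> (S h x) \<bullet> y" for y
  proof -
    have "S h (J \<mu> x) \<bullet> y = (\<integral>t. exp (- (\<mu> * t)) * (S h (S t x) \<bullet> y) \<partial>half_line)"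
      using assms by (intro J_functional bounded_linear_compose[OF bounded_linear_inner_left S_linear])
    also have "\<dots> = (\<integral>t. exp (- (\<mu> * t)) * (S t (S h x) \<bullet> y) \<partial>half_line)"
      using assms by (intro Bochner_Integration.integral_cong) (auto simp: add.commute simp flip: S_add)
    also have "\<dots> = J \<mu> (S h x) \<bullet> y"
      using assms by (intro J_functional[symmetric] bounded_linear_inner_left)
    finally show ?thesis .
  qed
  then show ?thesis by (intro vector_eq_rdot[THEN iffD1]) (simp add: inner_commute)
qed

text \<open>Shifting the Laplace integral by h shows that the vector on the left is the integral of
  x - e^(\<mu>(h-t)) S t x over 0 < t \<le> h. It is estimated by pairing it with itself.\<close>

lemma norm_difference_quotient_J_le:
  assumes \<mu>: "\<mu> > 0" and h: "h > 0"
    and e: "\<And>t. 0 < t \<Longrightarrow> t \<le> h \<Longrightarrow> norm (x - exp (\<mu> * (h - t)) *\<^sub>R S t x) \<le> e"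
  shows "norm (S h (J \<mu> x) - exp (\<mu> * h) *\<^sub>R J \<mu> x + h *\<^sub>R x) \<le> h * e"
proof -
  define d where "d = S h (J \<mu> x) - exp (\<mu> * h) *\<^sub>R J \<mu> x + h *\<^sub>R x"
  define F where "F t = exp (- (\<mu> * t)) * (S t x \<bullet> d)" for t
  have bl: "bounded_linear (\<lambda>u. u \<bullet> d)" by (rule bounded_linear_inner_left)
  have F: "integrable lborel (\<lambda>t. indicator {0<..} t * F t)"
    using integrable_Laplace[OF \<mu> bl, of x] by (simp add: integrable_restrict_space F_def)
  have "(\<lambda>t. indicator {h<..} t * F t) = (\<lambda>t. indicator {0<..} t * F t * indicator {h<..} t)"
    using h by (auto simp: fun_eq_iff indicator_def)
  then have F_h: "integrable lborel (\<lambda>t. indicator {h<..} t * F t)"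
    using integrable_real_mult_indicator[OF _ F, of "{h<..}"] by simp
  have const: "integrable lborel (\<lambda>t::real. indicator {0<..h} t * c)" for c :: real
    using h by (intro integrable_mult_left) (simp add: integrable_indicator_iff)
  have "S h (J \<mu> x) \<bullet> d = (\<integral>t. exp (- (\<mu> * t)) * (S t (S h x) \<bullet> d) \<partial>half_line)"
    using J_functional[OF \<mu> bl] h by (simp add: S_J \<mu>)
  also have "\<dots> = (\<integral>t. exp (\<mu> * h) * F (h + t) \<partial>half_line)"
    using h by (intro Bochner_Integration.integral_cong)
      (auto simp: F_def S_add add.commute[of h] ring_distribs simp flip: exp_add)
  also have "\<dots> = exp (\<mu> * h) * (\<integral>t. indicator {h<..} t * F t \<partial>lborel)"
    by (simp add: integral_half_line_shift)
  finally have "S h (J \<mu> x) \<bullet> d = (\<integral>t. exp (\<mu> * h) * (indicator {h<..} t * F t) \<partial>lborel)" by simp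
  moreover have "exp (\<mu> * h) *\<^sub>R J \<mu> x \<bullet> d = (\<integral>t. exp (\<mu> * h) * (indicator {0<..} t * F t) \<partial>lborel)"
    using J_functional[OF \<mu> bl] by (simp add: F_def integral_restrict_space)
  moreover have "h *\<^sub>R x \<bullet> d = (\<integral>t. indicator {0<..h} t * (x \<bullet> d) \<partial>lborel)"
    using h by simp
  ultimately have "d \<bullet> d = (\<integral>t. exp (\<mu> * h) * (indicator {h<..} t * F t)
      - exp (\<mu> * h) * (indicator {0<..} t * F t) + indicator {0<..h} t * (x \<bullet> d) \<partial>lborel)"
    using F F_h const by (subst (1) d_def) (simp add: inner_add_left inner_diff_left)
  also have "\<dots> \<le> (\<integral>t. indicator {0<..h} t * (e * norm d) \<partial>lborel)"
  proof (intro integral_mono)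
    fix t
    show "exp (\<mu> * h) * (indicator {h<..} t * F t) - exp (\<mu> * h) * (indicator {0<..} t * F t)
        + indicator {0<..h} t * (x \<bullet> d) \<le> indicator {0<..h} t * (e * norm d)"
    proof (cases "t \<in> {0<..h}")
      case True
      have "x \<bullet> d - exp (\<mu> * h) * F t = (x - exp (\<mu> * (h - t)) *\<^sub>R S t x) \<bullet> d"
        by (simp add: F_def inner_diff_left right_diff_distrib exp_diff exp_minus field_simps)
      also have "\<dots> \<le> e * norm d"
        using norm_cauchy_schwarz[of "x - exp (\<mu> * (h - t)) *\<^sub>R S t x" d] e[of t] True
        by (auto intro: order_trans[OF _ mult_right_mono])
      finally show ?thesis using True by simp
    qed (use h in \<open>auto simp: indicator_def\<close>)
  qed (use F F_h const in auto)
  also have "\<dots> = h * e * norm d" using h by simp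
  finally have "norm d * norm d \<le> h * e * norm d"
    by (simp add: power2_norm_eq_inner [symmetric] power2_eq_square)
  moreover have "0 \<le> h * e"
    using order_trans[OF norm_ge_zero e[of h]] h by simp
  ultimately have "norm d \<le> h * e"
    by (cases "norm d = 0") (auto simp: mult_le_cancel_right_pos)
  then show ?thesis by (simp add: d_def)
qed

text \<open>The difference quotient of \<open>J \<mu> x\<close> is the vector of
  \<open>norm_difference_quotient_J_le\<close> divided by h, plus ((e^(\<mu>h) - 1)/h) J \<mu> x,
  minus x. Strong continuity sends the first part to 0, and the second tends to \<mu> J \<mu>
  x.\<close>

lemma generator_J:
  assumes \<mu>: "\<mu> > 0"
  shows "J \<mu> x \<in> DA" "A (J \<mu> x) = \<mu> *\<^sub>R J \<mu> x - x"
proof -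
  let ?v = "J \<mu> x"
  have "((\<lambda>h. (S h ?v - exp (\<mu> * h) *\<^sub>R ?v + h *\<^sub>R x) /\<^sub>R h) \<longlongrightarrow> 0) (at_right 0)"
  proof (rule tendstoI)
    fix e :: real assume "e > 0"
    \<comment> \<open>The estimate below needs \<epsilon> (|x| + 1) \<le> e / 2, for which
      \<epsilon> m = e / 2 leaves room. The half makes the final inequality strict.\<close>
    define m where "m = norm x + 2"
    define \<epsilon> where "\<epsilon> = e / (2 * m)"
    have "m > 0" using norm_ge_zero[of x] unfolding m_def by linarith
    then have \<epsilon>: "\<epsilon> > 0" using \<open>e > 0\<close> by (simp add: \<epsilon>_def)
    have \<epsilon>_e: "\<epsilon> * m = e / 2" using \<open>m > 0\<close> by (simp add: \<epsilon>_def)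
    obtain d where "d > 0" and d: "\<And>t. 0 \<le> t \<Longrightarrow> t < d \<Longrightarrow> norm (S t x - x) < \<epsilon>"
      using S_near_identity \<epsilon> by blast
    have "((\<lambda>h. exp (\<mu> * h)) \<longlongrightarrow> exp (\<mu> * 0)) (at_right 0)"
      by (intro tendsto_intros)
    then have "\<forall>\<^sub>F h in at_right 0. dist (exp (\<mu> * h)) (exp (\<mu> * 0)) < \<epsilon>"
      using \<epsilon> by (rule tendstoD)
    moreover have "\<forall>\<^sub>F h in at_right 0. 0 < h \<and> h < d"
      using \<open>d > 0\<close> by (auto simp: eventually_at_right_field)
    ultimately show "\<forall>\<^sub>F h in at_right 0. dist ((S h ?v - exp (\<mu> * h) *\<^sub>R ?v + h *\<^sub>R x) /\<^sub>R h) 0 < e"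
    proof eventually_elim
      case (elim h)
      have "norm (x - exp (\<mu> * (h - t)) *\<^sub>R S t x) \<le> e / 2" if t: "0 < t" "t \<le> h" for t
      proof -
        have 1: "1 \<le> exp (\<mu> * (h - t))" "exp (\<mu> * (h - t)) \<le> exp (\<mu> * h)"
          using \<mu> t by auto
        moreover have "\<bar>exp (\<mu> * h) - 1\<bar> < \<epsilon>"
          using elim by (simp add: dist_real_def)
        ultimately have 2: "\<bar>1 - exp (\<mu> * (h - t))\<bar> \<le> \<epsilon>"
          by linarith
        have "norm (x - exp (\<mu> * (h - t)) *\<^sub>R S t x)
            = norm ((1 - exp (\<mu> * (h - t))) *\<^sub>R S t x - (S t x - x))"
          by (simp add: algebra_simps)
        also have "\<dots> \<le> \<bar>1 - exp (\<mu> * (h - t))\<bar> * norm (S t x) + norm (S t x - x)"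
          by (metis norm_scaleR norm_triangle_ineq4)
        also have "\<dots> \<le> \<epsilon> * norm x + \<epsilon>"
          using 2 elim t d[of t] norm_S_le[of t x] \<epsilon> by (intro add_mono mult_mono) (auto simp: dist_real_def)
        also have "\<dots> \<le> e / 2" unfolding \<epsilon>_e[symmetric] m_def using \<epsilon> by (simp add: algebra_simps)
        finally show ?thesis .
      qed
      then have "norm (S h ?v - exp (\<mu> * h) *\<^sub>R ?v + h *\<^sub>R x) \<le> h * (e / 2)"
        using elim by (intro norm_difference_quotient_J_le[OF \<mu>]) auto
      also have "\<dots> < h * e" using elim \<open>e > 0\<close> by simp
      finally show ?case
        unfolding dist_norm diff_zero norm_scaleR using elim
        by (simp add: field_simps del: norm_scaleR)
    qed
  qed
  moreover have "((\<lambda>h. (exp (\<mu> * h) - 1) / h) \<longlongrightarrow> \<mu>) (at_right 0)"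
  proof -
    have "((\<lambda>h. exp (\<mu> * h)) has_field_derivative \<mu>) (at 0)"
      by (auto intro!: derivative_eq_intros)
    then show ?thesis
      by (auto simp: has_field_derivative_iff intro: tendsto_mono[OF at_le])
  qed
  ultimately have "((\<lambda>h. (S h ?v - exp (\<mu> * h) *\<^sub>R ?v + h *\<^sub>R x) /\<^sub>R h + ((exp (\<mu> * h) - 1) / h) *\<^sub>R ?v - x)
      \<longlongrightarrow> 0 + \<mu> *\<^sub>R ?v - x) (at_right 0)"
    by (intro tendsto_intros)
  moreover have "\<forall>\<^sub>F h in at_right 0. (S h ?v - exp (\<mu> * h) *\<^sub>R ?v + h *\<^sub>R x) /\<^sub>R h + ((exp (\<mu> * h) - 1) / h) *\<^sub>R ?v - x
      = (S h ?v - ?v) /\<^sub>R h"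
  proof (intro eventually_mono[OF eventually_at_right_less[of 0]])
    fix h :: real assume "0 < h"
    have "((exp (\<mu> * h) - 1) / h) *\<^sub>R ?v = (exp (\<mu> * h) *\<^sub>R ?v - ?v) /\<^sub>R h"
      by (simp add: algebra_simps divide_inverse)
    then show "(S h ?v - exp (\<mu> * h) *\<^sub>R ?v + h *\<^sub>R x) /\<^sub>R h + ((exp (\<mu> * h) - 1) / h) *\<^sub>R ?v - x
      = (S h ?v - ?v) /\<^sub>R h"
      using \<open>0 < h\<close> by (simp add: algebra_simps)
  qed
  ultimately have "((\<lambda>h. (S h ?v - ?v) /\<^sub>R h) \<longlongrightarrow> 0 + \<mu> *\<^sub>R ?v - x) (at_right 0)"
    by (rule Lim_transform_eventually)
  then show "J \<mu> x \<in> DA" "A (J \<mu> x) = \<mu> *\<^sub>R J \<mu> x - x"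
    using generatorI by auto
qed

lemma resolvent_eq_J: "\<mu> > 0 \<Longrightarrow> resolvent DA A (complex_of_real \<mu>) x = J \<mu> x"
  by (rule resolvent_eqI) (auto simp: generator_J scaleC_of_real)

text \<open>Writing elements of the domain as \<open>J 1 w\<close> later replaces C by the bounded
  operator \<open>B\<close>, and initial values in D(A) by arbitrary w.\<close>

lemma dom_eq_range: "DA = range (J 1)"
proof
  show "DA \<subseteq> range (J 1)"
  proof
    fix x assume x: "x \<in> DA"
    have "resolvent DA A 1 (x - A x) = x"
      by (rule resolvent_eqI) (use x in auto)
    then show "x \<in> range (J 1)" using resolvent_eq_J[of 1 "x - A x"] by (metis of_real_1 rangeI zero_less_one)
  qed
qed (auto simp: generator_J)

text \<open>\<mu> J \<mu> x tends to x because \<mu> e^(-\<mu>t) is a probability density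
  concentrating at 0. Density is used at the very end: admissibility of C concerns initial values in
  D(A), discrete admissibility concerns all x.\<close>

lemma dom_dense:
  assumes "e > 0"
  obtains y where "y \<in> DA" "norm (y - x) < e"
proof -
  obtain d where "d > 0" and d: "\<And>t. 0 \<le> t \<Longrightarrow> t < d \<Longrightarrow> norm (S t x - x) < e / 2"
    using S_near_identity assms half_gt_zero by blast
  \<comment> \<open>Makes 2 |x| / (d \<mu>), the part of the bound coming from the linear term in t,
    smaller than e / 2. The summand 1 makes the inequality strict and \<mu> positive.\<close>
  define \<mu> where "\<mu> = 1 + 4 * norm x / (d * e)"
  have \<mu>: "\<mu> > 0" using \<open>d > 0\<close> \<open>e > 0\<close> by (auto simp: \<mu>_def intro!: add_pos_nonneg)
  let ?b = "\<lambda>t. (\<mu> * (e / 2)) * exp (- (\<mu> * t)) + (\<mu> * (2 * norm x / d)) * (t powr 0 * exp (- (\<mu> * t)) * t ^ 1)"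
  have b: "has_bochner_integral half_line ?b (e / 2 + 2 * norm x / (d * \<mu>))"
  proof -
    have "has_bochner_integral half_line ?b ((\<mu> * (e / 2)) * (1 / \<mu>)
        + (\<mu> * (2 * norm x / d)) * (Gamma (0 + real 1 + 1) / \<mu> powr (0 + real 1 + 1)))"
      using \<mu> by (intro has_bochner_integral_add has_bochner_integral_mult_right has_bochner_integral_exp
          has_bochner_integral_Gamma_power) auto
    moreover have "Gamma (0 + real 1 + 1) = 1"
      using Gamma_fact[of 1, where 'a = real] by simp
    moreover have "\<mu> powr (0 + real 1 + 1) = \<mu> * \<mu>"
      using \<mu> by (simp add: powr_numeral power2_eq_square)
    ultimately show ?thesis using \<mu> by (simp add: mult_ac)
  qed
  have bnd: "dominated (\<lambda>t. (\<mu> * exp (- (\<mu> * t))) *\<^sub>R (S t x - x)) ?b"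
    unfolding dominated_def
  proof (intro conjI allI impI)
    show "continuous_on {0<..} (\<lambda>t. (\<mu> * exp (- (\<mu> * t))) *\<^sub>R (S t x - x))"
      by (intro continuous_intros continuous_on_subset[OF continuous_on_S]) auto
    show "integrable half_line ?b" using b by (simp add: has_bochner_integral_iff)
    fix t :: real assume t: "t > 0"
    \<comment> \<open>One affine majorant for all t: near 0 by the choice of d, and for t \<ge> d
      because t / d \<ge> 1 absorbs the trivial bound 2 |x|. It integrates against the density in
      closed form.\<close>
    have "norm (S t x - x) \<le> e / 2 + 2 * norm x / d * t"
    proof (cases "t < d")
      case True
      then show ?thesis using d[of t] t \<open>d > 0\<close> by (intro order_trans[OF less_imp_le[OF d]]) auto
    next
      case False
      have "norm (S t x - x) \<le> norm x + norm x"
        using norm_S_le[of t x] t norm_triangle_ineq4[of "S t x" x] by simp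
      also have "\<dots> \<le> 2 * norm x / d * t"
        using False \<open>d > 0\<close> mult_left_mono[of d t "2 * norm x"] by (simp add: field_simps)
      finally show ?thesis using \<open>e > 0\<close> by simp
    qed
    then have "\<mu> * exp (- (\<mu> * t)) * norm (S t x - x) \<le> \<mu> * exp (- (\<mu> * t)) * (e / 2 + 2 * norm x / d * t)"
      using \<mu> by (intro mult_left_mono) auto
    also have "\<dots> = ?b t" using t by (simp add: algebra_simps)
    finally show "norm ((\<mu> * exp (- (\<mu> * t))) *\<^sub>R (S t x - x)) \<le> ?b t"
      using \<mu> by simp
  qed
  have "weak_integral (\<lambda>t. (\<mu> * exp (- (\<mu> * t))) *\<^sub>R (S t x - x)) = \<mu> *\<^sub>R J \<mu> x - x"
  proof (rule weak_integral_eqI[OF bnd])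
    fix y
    have "(\<integral>t. (\<mu> * exp (- (\<mu> * t))) *\<^sub>R (S t x - x) \<bullet> y \<partial>half_line)
        = (\<integral>t. \<mu> * (exp (- (\<mu> * t)) * (S t x \<bullet> y)) - \<mu> * (x \<bullet> y) * exp (- (\<mu> * t)) \<partial>half_line)"
      by (intro Bochner_Integration.integral_cong) (auto simp: inner_diff_left algebra_simps)
    also have "\<dots> = \<mu> * (J \<mu> x \<bullet> y) - \<mu> * (x \<bullet> y) * (1 / \<mu>)"
      using J_functional[OF \<mu> bounded_linear_inner_left[of y], of x] has_bochner_integral_exp[OF \<mu>]
        integrable_Laplace[OF \<mu> bounded_linear_inner_left[of y], of x]
      by (simp add: has_bochner_integral_iff)
    finally show "(\<mu> *\<^sub>R J \<mu> x - x) \<bullet> y = (\<integral>t. (\<mu> * exp (- (\<mu> * t))) *\<^sub>R (S t x - x) \<bullet> y \<partial>half_line)"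
      using \<mu> by (simp add: inner_diff_left)
  qed
  then have "norm (\<mu> *\<^sub>R J \<mu> x - x) \<le> e / 2 + 2 * norm x / (d * \<mu>)"
    using norm_weak_integral_le[OF bnd] b by (simp add: has_bochner_integral_iff)
  also have "2 * norm x / (d * \<mu>) < e / 2"
  proof -
    have "4 * norm x < d * e * \<mu>"
      using \<open>d > 0\<close> \<open>e > 0\<close> by (simp add: \<mu>_def distrib_left)
    then show ?thesis using \<open>d > 0\<close> \<mu> by (simp add: field_simps)
  qed
  finally have "norm (\<mu> *\<^sub>R J \<mu> x - x) < e" by simp
  moreover have "\<mu> *\<^sub>R J \<mu> x \<in> DA"
  proof -
    have "((\<lambda>h. \<mu> *\<^sub>R ((S h (J \<mu> x) - J \<mu> x) /\<^sub>R h)) \<longlongrightarrow> \<mu> *\<^sub>R A (J \<mu> x)) (at_right 0)"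
      by (intro tendsto_intros generator_tendsto generator_J \<mu>)
    then have "((\<lambda>h. (S h (\<mu> *\<^sub>R J \<mu> x) - \<mu> *\<^sub>R J \<mu> x) /\<^sub>R h) \<longlongrightarrow> \<mu> *\<^sub>R A (J \<mu> x)) (at_right 0)"
      by (rule Lim_transform_eventually)
        (intro eventually_mono[OF eventually_at_right_less[of 0]], simp add: S_scaleR algebra_simps)
    then show ?thesis by (rule generatorI)
  qed
  ultimately show ?thesis using that by blast
qed

end

section \<open>Resolvents in terms of the cogenerator\<close>

lemma has_bochner_integral_powr_below:
  fixes p r :: real
  assumes "p > -1" "r > 0"
  shows "has_bochner_integral half_line (\<lambda>s. indicator {..r} s * s powr p) (r powr (p + 1) / (p + 1))"
proof (rule has_bochner_integral_half_line_HK)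
  have "((\<lambda>s. if s \<in> {0..r} then s powr p else 0) has_integral r powr (p + 1) / (p + 1)) UNIV"
    using has_integral_powr_from_0[of p r] assms by (simp only: has_integral_restrict_UNIV)
  then have "((\<lambda>s. if s \<in> {0<..} then indicator {..r} s * s powr p else 0) has_integral r powr (p + 1) / (p + 1)) UNIV"
    by (rule has_integral_spike[of "{0}", rotated 2]) (auto simp: indicator_def)
  then show "((\<lambda>s. indicator {..r} s * s powr p) has_integral r powr (p + 1) / (p + 1)) {0<..}"
    by (simp only: has_integral_restrict_UNIV)
qed auto

lemma has_bochner_integral_powr_above:
  fixes q r :: real
  assumes "q < -1" "r > 0"
  shows "has_bochner_integral half_line (\<lambda>s. indicator {r<..} s * s powr q) (- (r powr (q + 1)) / (q + 1))"
proof (rule has_bochner_integral_half_line_HK)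
  have "((\<lambda>s. if s \<in> {r..} then s powr q else 0) has_integral - (r powr (q + 1)) / (q + 1)) UNIV"
    using has_integral_powr_to_inf[of q r] assms by (simp only: has_integral_restrict_UNIV)
  then have "((\<lambda>s. if s \<in> {0<..} then indicator {r<..} s * s powr q else 0) has_integral - (r powr (q + 1)) / (q + 1)) UNIV"
    by (rule has_integral_spike[of "{r}", rotated 2]) (use assms in \<open>auto simp: indicator_def\<close>)
  then show "((\<lambda>s. indicator {r<..} s * s powr q) has_integral - (r powr (q + 1)) / (q + 1)) {0<..}"
    by (simp only: has_integral_restrict_UNIV)
qed auto

lemma bounded_clinearD:
  assumes "bounded_clinear f"
  shows "bounded_linear f" "f (c *\<^sub>C x) = c *\<^sub>C f x" "f (x + y) = f x + f y" "f (x - y) = f x - f y"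
  using assms
  by (auto simp: bounded_clinear_def linear_add linear_diff bounded_linear.linear)

locale cogenerator = contraction_semigroup S
  for S :: "real \<Rightarrow> 'a::chilbert_space \<Rightarrow> 'a" +
  fixes T :: "'a \<Rightarrow> 'a"
  assumes T_clinear: "bounded_clinear T" and onorm_T: "onorm T \<le> 1"
    and cogenerator: "cogenerator_of T S"
begin

lemmas T_simps = bounded_clinearD(2-4)[OF T_clinear]

lemma norm_T_le: "norm (T x) \<le> norm x"
  using onorm[OF bounded_clinearD(1)[OF T_clinear], of x] mult_right_mono[OF onorm_T, of "norm x"] by simp

text \<open>A (I - A)^-1 = (I - A)^-1 - I. Consequently \<open>J 1\<close> is (I + T)/2 and inherits
  boundedness and complex linearity from T.\<close>

lemma T_eq: "T x = 2 *\<^sub>R J 1 x - x"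
proof -
  have "T x = resolvent DA A 1 x + A (resolvent DA A 1 x)"
    using cogenerator by (simp add: cogenerator_of_def)
  then show ?thesis
    using resolvent_eq_J[of 1 x] generator_J(2)[of 1 x] by (simp add: scaleR_2)
qed

lemma J1_eq: "J 1 x = (1 / 2) *\<^sub>R (x + T x)"
  by (simp add: T_eq)

lemma J1_clinear: "bounded_clinear (J 1)"
proof -
  have "bounded_linear (\<lambda>x. (1 / 2) *\<^sub>R (x + T x))"
    by (intro bounded_linear_compose[OF bounded_linear_scaleR_right] bounded_linear_add
        bounded_linear_ident bounded_clinearD T_clinear)
  then show ?thesis
    by (simp add: bounded_clinear_def J1_eq [abs_def] T_simps scaleC_add_right scaleC_scaleR)
qed

lemmas J1_simps = bounded_clinearD(2-4)[OF J1_clinear]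

lemma norm_J1_le: "norm (J 1 x) \<le> norm x"
  using norm_triangle_ineq[of x "T x"] norm_T_le[of x] by (simp add: J1_eq)

definition G :: "complex \<Rightarrow> 'a \<Rightarrow> 'a"
  where "G z = inv (\<lambda>x. x - z *\<^sub>C T x)"

text \<open>A solution is a fixed point of the map w -> y + z T w, which contracts by the factor |z|
  because T is a contraction.\<close>

lemma ex1_G:
  assumes "cmod z < 1"
  shows "\<exists>!w. w - z *\<^sub>C T w = y"
proof -
  have "\<exists>!w. y + z *\<^sub>C T w = w"
  proof (rule banach_fix_type[of "cmod z"])
    have "dist (y + z *\<^sub>C T u) (y + z *\<^sub>C T v) = cmod z * norm (T (u - v))" for u v
      by (simp add: dist_norm norm_scaleC T_simps flip: scaleC_diff_right)
    then show "\<forall>u v. dist (y + z *\<^sub>C T u) (y + z *\<^sub>C T v) \<le> cmod z * dist u v"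
      by (simp add: dist_norm norm_T_le mult_left_mono)
  qed (use assms in auto)
  moreover have "y + z *\<^sub>C T w = w \<longleftrightarrow> w - z *\<^sub>C T w = y" for w
    by (auto simp: algebra_simps)
  ultimately show ?thesis by simp
qed

lemma G_props:
  assumes "cmod z < 1"
  shows "G z y - z *\<^sub>C T (G z y) = y" "G z (x - z *\<^sub>C T x) = x"
proof -
  have bij: "bij (\<lambda>x. x - z *\<^sub>C T x)"
    using ex1_G[OF assms] by (simp add: bij_iff)
  show "G z y - z *\<^sub>C T (G z y) = y"
    unfolding G_def using surj_f_inv_f[OF bij_is_surj[OF bij], of y] .
  show "G z (x - z *\<^sub>C T x) = x"
    unfolding G_def using inv_f_f[OF bij_is_inj[OF bij], of x] .
qed

lemma norm_G_le:
  assumes "cmod z < 1"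
  shows "norm (G z y) \<le> norm y / (1 - cmod z)"
proof -
  have "G z y = y + z *\<^sub>C T (G z y)"
    using G_props(1)[OF assms, of y] by (simp add: diff_eq_eq)
  then have "norm (G z y) \<le> norm y + cmod z * norm (T (G z y))"
    by (metis norm_scaleC norm_triangle_ineq)
  also have "\<dots> \<le> norm y + cmod z * norm (G z y)"
    by (simp add: norm_T_le mult_left_mono)
  finally show ?thesis using assms by (simp add: field_simps)
qed

lemma G_clinear:
  assumes z: "cmod z < 1"
  shows "bounded_clinear (G z)"
proof -
  have scale: "G z (c *\<^sub>C x) = c *\<^sub>C G z x" for c x
  proof -
    have "c *\<^sub>C x = c *\<^sub>C G z x - z *\<^sub>C T (c *\<^sub>C G z x)"
      using arg_cong[OF G_props(1)[OF z, of x], of "scaleC c"]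
      by (simp add: T_simps scaleC_diff_right scaleC_scaleC mult.commute)
    then show ?thesis by (metis G_props(2)[OF z])
  qed
  have add: "G z (x + y) = G z x + G z y" for x y
  proof -
    have "x + y = (G z x - z *\<^sub>C T (G z x)) + (G z y - z *\<^sub>C T (G z y))"
      by (simp add: G_props(1)[OF z])
    also have "\<dots> = (G z x + G z y) - z *\<^sub>C T (G z x + G z y)"
      by (simp add: T_simps scaleC_add_right)
    finally show ?thesis by (metis G_props(2)[OF z])
  qed
  have "bounded_linear (G z)"
  proof (rule bounded_linear_intro[where K = "1 / (1 - cmod z)"])
    show "G z (r *\<^sub>R x) = r *\<^sub>R G z x" for r x
      using scale[of "of_real r" x] by (simp add: scaleC_of_real)
    show "norm (G z x) \<le> norm x * (1 / (1 - cmod z))" for x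
      using norm_G_le[OF z] by simp
  qed (rule add)
  then show ?thesis by (simp add: bounded_clinear_def scale)
qed

text \<open>For T = (I + A)(I - A)^-1 and this z one has I - z T = (2 / (1 + l)) (l - A)(I - A)^-1,
  so the Cayley transform exchanges the discrete and the continuous resolvent. The third identity
  turns the weight 1 - |z|^2 into Re l and brings in the powers of |1 + l|.\<close>

lemma cayley:
  assumes "Re l > 0"
  defines "z \<equiv> (1 - l) / (1 + l)"
  shows "cmod z < 1" "1 + l \<noteq> 0" "1 - (cmod z)\<^sup>2 = 4 * Re l / (cmod (1 + l))\<^sup>2"
proof -
  show nz: "1 + l \<noteq> 0" using assms by (auto simp: complex_eq_iff)
  have "(cmod (1 + l))\<^sup>2 - (cmod (1 - l))\<^sup>2 = 4 * Re l"
    by (simp only: cmod_power2) (simp add: power2_eq_square algebra_simps)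
  then show eq: "1 - (cmod z)\<^sup>2 = 4 * Re l / (cmod (1 + l))\<^sup>2"
    using nz by (simp add: z_def norm_divide power_divide diff_divide_eq_iff)
  then have "(cmod z)\<^sup>2 < 1"
    using assms nz by (smt (verit) divide_pos_pos zero_less_norm_iff zero_less_power)
  then show "cmod z < 1" by (simp add: power2_less_1_iff abs_square_less_1)
qed

text \<open>This is (I - A)R(l, A), expressed through T so that it is everywhere defined and bounded
  from the start.\<close>

definition E :: "complex \<Rightarrow> 'a \<Rightarrow> 'a"
  where "E l x = (2 / (1 + l)) *\<^sub>C G ((1 - l) / (1 + l)) x"

text \<open>The inverse (l - A)(I - A)^-1 of \<open>E l\<close>. Being affine in \<open>J 1\<close>,
  it commutes with \<open>J 1\<close> and with every \<open>N m\<close>, and \<open>E l\<close>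
  inherits this.\<close>

definition N :: "complex \<Rightarrow> 'a \<Rightarrow> 'a"
  where "N l w = w + (l - 1) *\<^sub>C J 1 w"

lemma N_eq:
  assumes "Re l > 0"
  shows "N l w = ((1 + l) / 2) *\<^sub>C (w - ((1 - l) / (1 + l)) *\<^sub>C T w)"
proof -
  have nz: "1 + l \<noteq> 0" using cayley[OF assms] by simp
  have "N l w = w + (l - 1) *\<^sub>C ((1 / 2) *\<^sub>C (w + T w))"
    by (simp add: N_def J1_eq scaleC_of_real [symmetric])
  also have "\<dots> = (1 + (l - 1) / 2) *\<^sub>C w + ((l - 1) / 2) *\<^sub>C T w"
    by (simp add: scaleC_add_left scaleC_add_right scaleC_scaleC)
  also have "1 + (l - 1) / 2 = (1 + l) / 2" by (simp add: field_simps)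
  also have "(l - 1) / 2 = - ((1 + l) / 2 * ((1 - l) / (1 + l)))"
  proof -
    have "m / 2 * (k / m) = k / 2" if "m \<noteq> 0" for m k :: complex using that by simp
    from this[OF nz, of "1 - l"] show ?thesis by (simp add: field_simps)
  qed
  finally show ?thesis
    by (simp only: scaleC_diff_right scaleC_scaleC scaleC_minus_left) simp
qed

lemma E_clinear: "Re l > 0 \<Longrightarrow> bounded_clinear (E l)"
  using G_clinear[OF cayley(1), of l]
  by (auto simp: bounded_clinear_def E_def [abs_def] scaleC_scaleC mult.commute
      intro: bounded_linear_compose[OF bounded_linear_scaleC])

lemma N_E: "Re l > 0 \<Longrightarrow> N l (E l x) = x"
  and E_N: "Re l > 0 \<Longrightarrow> E l (N l x) = x"
proof -
  assume l: "Re l > 0"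
  let ?z = "(1 - l) / (1 + l)"
  have z: "cmod ?z < 1" and nz: "1 + l \<noteq> 0" using cayley[OF l] by auto
  have "E l x - ?z *\<^sub>C T (E l x) = (2 / (1 + l)) *\<^sub>C (G ?z x - ?z *\<^sub>C T (G ?z x))"
    by (simp add: E_def T_simps scaleC_diff_right scaleC_scaleC mult.commute)
  also have "\<dots> = (2 / (1 + l)) *\<^sub>C x" by (simp only: G_props(1)[OF z])
  finally have "E l x - ?z *\<^sub>C T (E l x) = (2 / (1 + l)) *\<^sub>C x" .
  moreover have c: "m / 2 * (2 / m) = 1" if "m \<noteq> 0" for m :: complex using that by simp
  ultimately show "N l (E l x) = x"
    by (simp only: N_eq[OF l] scaleC_scaleC c[OF nz] scaleC_one)
  show "E l (N l x) = x"
    by (simp only: E_def N_eq[OF l] bounded_clinearD(2)[OF G_clinear[OF z]] G_props(2)[OF z] scaleC_scaleC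
        mult.commute[of "2 / (1 + l)"] c[OF nz] scaleC_one)
qed

lemma N_commute: "N l (N m x) = N m (N l x)"
  by (simp add: N_def J1_simps scaleC_add_right scaleC_scaleC mult.commute algebra_simps)

lemma E_commute:
  assumes l: "Re l > 0" and m: "Re m > 0"
  shows "E l (E m x) = E m (E l x)"
proof -
  have "N m (N l (E m (E l x))) = x"
    by (simp add: N_commute[of m l] N_E l m)
  then show ?thesis by (metis E_N l m)
qed

lemma E_J1_commute:
  assumes l: "Re l > 0"
  shows "E l (J 1 x) = J 1 (E l x)"
proof -
  have "N l (J 1 y) = J 1 (N l y)" for y by (simp add: N_def J1_simps)
  from this[of "E l x"] show ?thesis by (metis E_N N_E l)
qed

lemma resolvent_eq_E:
  assumes l: "Re l > 0"
  shows "resolvent DA A l y = J 1 (E l y)"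
proof (rule resolvent_eqI[OF l])
  show "J 1 (E l y) \<in> DA" by (simp add: generator_J)
  have "l *\<^sub>C J 1 (E l y) - A (J 1 (E l y)) = N l (E l y)"
    by (simp add: generator_J N_def scaleC_diff_left algebra_simps)
  then show "l *\<^sub>C J 1 (E l y) - A (J 1 (E l y)) = y" by (simp add: N_E l)
qed

lemma J_eq_E: "\<mu> > 0 \<Longrightarrow> J \<mu> x = J 1 (E (of_real \<mu>) x)"
  using resolvent_eq_J[of \<mu> x] resolvent_eq_E[of "of_real \<mu>" x] by simp

text \<open>For w = E m (E l x) one has E l x = N m w and E m x = N l w, so both identities are
  linear relations between w and J 1 w. The first gives Lipschitz continuity in the parameter. In
  the second \<open>J 1\<close> has been eliminated, so that division by l - m bounds the product E
  m E l through its single factors.\<close>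

lemma resolvent_identity_E:
  assumes l: "Re l > 0" and m: "Re m > 0"
  shows "E l x - E m x = (m - l) *\<^sub>C J 1 (E m (E l x))"
    and "(l - 1) *\<^sub>C E l x - (m - 1) *\<^sub>C E m x = (l - m) *\<^sub>C E m (E l x)"
proof -
  define w where "w = E m (E l x)"
  have 1: "E l x = N m w" by (simp add: w_def N_E m)
  have 2: "E m x = N l w" by (simp add: w_def E_commute[OF m l] N_E l)
  show "E l x - E m x = (m - l) *\<^sub>C J 1 (E m (E l x))"
    unfolding w_def[symmetric] unfolding 1 2 by (simp add: N_def scaleC_diff_left)
  show "(l - 1) *\<^sub>C E l x - (m - 1) *\<^sub>C E m x = (l - m) *\<^sub>C E m (E l x)"
    unfolding w_def[symmetric] unfolding 1 2
    by (simp add: N_def scaleC_diff_left scaleC_diff_right scaleC_add_right scaleC_scaleC algebra_simps)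
qed

text \<open>For l = 1 + s the Cayley point has modulus s / (2 + s), and the bound 1 / (1 - |z|) = (2
  + s) / 2 for \<open>G\<close> is cancelled exactly by the factor 2 / (2 + s) in
  \<open>E\<close>.\<close>

lemma norm_E_real_le:
  assumes "s \<ge> 0"
  shows "norm (E (1 + of_real s) x) \<le> norm x"
proof -
  let ?z = "(1 - (1 + complex_of_real s)) / (1 + (1 + complex_of_real s))"
  have "?z = complex_of_real (- (s / (2 + s)))" by (simp add: field_simps)
  then have z: "cmod ?z = s / (2 + s)" using assms by (simp only: norm_of_real) simp
  have "cmod (1 + (1 + complex_of_real s)) = 2 + s"
  proof -
    have "1 + (1 + complex_of_real s) = complex_of_real (2 + s)" by simp
    then show ?thesis using assms by (simp only: norm_of_real)
  qed
  then have "norm (E (1 + of_real s) x) = 2 / (2 + s) * norm (G ?z x)"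
    by (simp only: E_def norm_scaleC norm_divide) simp
  also have "\<dots> \<le> 2 / (2 + s) * (norm x / (1 - cmod ?z))"
    using z assms by (intro mult_left_mono norm_G_le) auto
  also have "\<dots> = norm x" unfolding z using assms by (simp add: field_simps)
  finally show ?thesis .
qed

lemma continuous_on_E_real: "continuous_on {0..} (\<lambda>s. E (1 + of_real s) x)"
proof (rule lipschitz_on_continuous_on[where L = "norm x"], rule lipschitz_onI)
  fix s t :: real assume "s \<in> {0..}" "t \<in> {0..}"
  then have st: "s \<ge> 0" "t \<ge> 0" by auto
  have "dist (E (1 + of_real s) x) (E (1 + of_real t) x)
      = cmod (of_real (t - s)) * norm (J 1 (E (1 + of_real t) (E (1 + of_real s) x)))"
    using resolvent_identity_E(1)[of "1 + of_real s" "1 + of_real t" x] st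
    by (simp add: dist_norm norm_scaleC)
  also have "\<dots> \<le> \<bar>t - s\<bar> * norm x"
    using st by (simp only: norm_of_real)
      (intro mult_left_mono order_trans[OF norm_J1_le] order_trans[OF norm_E_real_le] norm_E_real_le, auto)
  finally show "dist (E (1 + of_real s) x) (E (1 + of_real t) x) \<le> norm x * dist s t"
    by (simp add: dist_real_def abs_minus_commute mult.commute)
qed simp

end

section \<open>The fractional power of the observation operator\<close>

text \<open>The last assumption is the discrete resolvent condition carried over to the right half
  plane, as a bound for D(I - A)R(l, A). Its extra decay |1 + l|^-\<alpha> is what pays for the
  fractional power in \<open>B\<close>.\<close>

locale output_estimate = cogenerator S T
  for S :: "real \<Rightarrow> 'a::chilbert_space \<Rightarrow> 'a" and T :: "'a \<Rightarrow> 'a" +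
  fixes D :: "'a \<Rightarrow> 'b::chilbert_space" and \<alpha> K :: real
  assumes \<alpha>: "0 < \<alpha>" "\<alpha> < 1" and D_clinear: "bounded_clinear D" and K: "K \<ge> 0"
    and norm_DE_le: "Re l > 0 \<Longrightarrow>
      norm (D (E l x)) \<le> K * Re l powr (- ((1 - \<alpha>) / 2)) * cmod (1 + l) powr (- \<alpha>) * norm x"
begin

lemmas D_simps = bounded_clinearD(2-4)[OF D_clinear]
lemmas D_linear = bounded_clinearD(1)[OF D_clinear]

text \<open>Two regimes for s^(\<alpha>-1) D E(1 + s): boundedness of the second factor gives
  integrability at 0, and its decay gives the order s^((\<alpha>-3)/2) at infinity, where
  (\<alpha>-3)/2 < -1.\<close>

lemma norm_DE_real_le:
  assumes s: "s > 0"
  shows "norm (D (E (1 + of_real s) x)) \<le> K * norm x"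
    and "norm (D (E (1 + of_real s) x)) \<le> K * s powr (- ((1 + \<alpha>) / 2)) * norm x"
proof -
  have "Re (1 + complex_of_real s) = 1 + s" by simp
  moreover have "cmod (1 + (1 + complex_of_real s)) = 2 + s"
  proof -
    have "1 + (1 + complex_of_real s) = complex_of_real (2 + s)" by simp
    then show ?thesis using s by (simp only: norm_of_real)
  qed
  ultimately have *: "norm (D (E (1 + of_real s) x))
      \<le> K * ((1 + s) powr (- ((1 - \<alpha>) / 2)) * (2 + s) powr (- \<alpha>)) * norm x"
    using norm_DE_le[of "1 + of_real s" x] s by (simp add: mult.assoc)
  have "(1 + s) powr (- ((1 - \<alpha>) / 2)) \<le> 1 powr (- ((1 - \<alpha>) / 2))"
    "(2 + s) powr (- \<alpha>) \<le> 1 powr (- \<alpha>)"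
    using powr_mono2'[of "- ((1 - \<alpha>) / 2)" 1 "1 + s"] powr_mono2'[of "- \<alpha>" 1 "2 + s"] s \<alpha> by auto
  then have "(1 + s) powr (- ((1 - \<alpha>) / 2)) * (2 + s) powr (- \<alpha>) \<le> 1 * 1"
    by (intro mult_mono) auto
  then have "K * ((1 + s) powr (- ((1 - \<alpha>) / 2)) * (2 + s) powr (- \<alpha>)) * norm x \<le> K * 1 * norm x"
    using K by (intro mult_right_mono mult_left_mono) auto
  with * show "norm (D (E (1 + of_real s) x)) \<le> K * norm x" by simp
  have "(1 + s) powr (- ((1 - \<alpha>) / 2)) \<le> s powr (- ((1 - \<alpha>) / 2))"
    "(2 + s) powr (- \<alpha>) \<le> s powr (- \<alpha>)"
    using s \<alpha> by (auto intro!: powr_mono2')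
  then have "(1 + s) powr (- ((1 - \<alpha>) / 2)) * (2 + s) powr (- \<alpha>)
      \<le> s powr (- ((1 - \<alpha>) / 2)) * s powr (- \<alpha>)"
    by (intro mult_mono) auto
  also have "\<dots> = s powr (- ((1 + \<alpha>) / 2))"
  proof -
    have "- ((1 - \<alpha>) / 2) + - \<alpha> = - ((1 + \<alpha>) / 2)" by (simp add: field_simps)
    then show ?thesis by (simp only: powr_add [symmetric])
  qed
  finally have "K * ((1 + s) powr (- ((1 - \<alpha>) / 2)) * (2 + s) powr (- \<alpha>)) * norm x
      \<le> K * s powr (- ((1 + \<alpha>) / 2)) * norm x"
    using K by (intro mult_right_mono mult_left_mono) auto
  with * show "norm (D (E (1 + of_real s) x)) \<le> K * s powr (- ((1 + \<alpha>) / 2)) * norm x" by simp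
qed

text \<open>Balakrishnan's integrand for I - A is s^(\<alpha>-1) (I - A)(s + I - A)^-1. Since (s + I
  - A)^-1 = R(1 + s, A), the operator in it is E (1 + s).\<close>

definition g :: "'a \<Rightarrow> real \<Rightarrow> 'b"
  where "g x s = s powr (\<alpha> - 1) *\<^sub>R D (E (1 + of_real s) x)"

text \<open>Balakrishnan's formula: up to a constant factor, \<open>B\<close> is \<open>D(I - A)\<^sup>\<alpha>\<close>.\<close>

definition B :: "'a \<Rightarrow> 'b"
  where "B x = weak_integral (g x)"

lemma continuous_on_g: "continuous_on {0<..} (g x)"
  unfolding g_def
  by (intro continuous_intros bounded_linear.continuous_on[OF D_linear]
      continuous_on_subset[OF continuous_on_E_real]) auto

definition majorant :: "real \<Rightarrow> real"
  where "majorant s = indicator {..1} s * s powr (\<alpha> - 1) + indicator {1<..} s * s powr ((\<alpha> - 3) / 2)"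

lemma integrable_majorant: "integrable half_line majorant"
proof -
  have "has_bochner_integral half_line majorant
      (1 powr (\<alpha> - 1 + 1) / (\<alpha> - 1 + 1) + - (1 powr ((\<alpha> - 3) / 2 + 1)) / ((\<alpha> - 3) / 2 + 1))"
    unfolding majorant_def using \<alpha>
    by (intro has_bochner_integral_add has_bochner_integral_powr_below has_bochner_integral_powr_above) auto
  then show ?thesis by (simp add: has_bochner_integral_iff)
qed

lemma dominated_g: "dominated (g x) (\<lambda>s. K * norm x * majorant s)"
  unfolding dominated_def
proof (intro conjI allI impI continuous_on_g)
  show "integrable half_line (\<lambda>s. K * norm x * majorant s)"
    using integrable_majorant by simp
  fix s :: real assume s: "s > 0"
  show "norm (g x s) \<le> K * norm x * majorant s"
  proof (cases "s \<le> 1")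
    case True
    then show ?thesis
      using mult_left_mono[OF norm_DE_real_le(1)[OF s, of x], of "s powr (\<alpha> - 1)"]
      by (simp add: g_def majorant_def mult_ac)
  next
    case False
    have "(\<alpha> - 3) / 2 = (\<alpha> - 1) + - ((1 + \<alpha>) / 2)" by (simp add: field_simps)
    then have "s powr ((\<alpha> - 3) / 2) = s powr (\<alpha> - 1) * s powr (- ((1 + \<alpha>) / 2))"
      by (simp only: powr_add)
    then show ?thesis
      using False mult_left_mono[OF norm_DE_real_le(2)[OF s, of x], of "s powr (\<alpha> - 1)"]
      by (simp add: g_def majorant_def mult_ac)
  qed
qed

lemma E_real_clinear: "s > 0 \<Longrightarrow> bounded_clinear (E (1 + complex_of_real s))"
  by (intro E_clinear) simp

lemma B_clinear: "bounded_clinear B"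
proof -
  have scale: "B (c *\<^sub>C x) = c *\<^sub>C B x" for c x
  proof -
    have "B (c *\<^sub>C x) = weak_integral (\<lambda>s. c *\<^sub>C g x s)"
      unfolding B_def by (intro weak_integral_cong)
        (simp add: g_def bounded_clinearD(2)[OF E_real_clinear] D_simps scaleC_scaleR)
    also have "\<dots> = c *\<^sub>C B x"
      unfolding B_def by (rule weak_integral_linear[OF dominated_g bounded_linear_scaleC, symmetric])
    finally show ?thesis .
  qed
  have add: "B (x + y) = B x + B y" for x y
  proof -
    have "B (x + y) = weak_integral (\<lambda>s. g x s + g y s)"
      unfolding B_def by (intro weak_integral_cong)
        (simp add: g_def bounded_clinearD(3)[OF E_real_clinear] D_simps scaleR_add_right)
    also have "\<dots> = B x + B y"
      unfolding B_def by (rule weak_integral_add[OF dominated_g dominated_g])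
    finally show ?thesis .
  qed
  have "bounded_linear B"
  proof (rule bounded_linear_intro[where K = "K * (\<integral>s. majorant s \<partial>half_line)"])
    show "B (r *\<^sub>R x) = r *\<^sub>R B x" for r x
      using scale[of "of_real r" x] by (simp add: scaleC_of_real)
    show "norm (B x) \<le> norm x * (K * (\<integral>s. majorant s \<partial>half_line))" for x
      using norm_weak_integral_le[OF dominated_g, of x] by (simp add: B_def mult_ac)
  qed (rule add)
  then show ?thesis by (simp add: bounded_clinear_def scale)
qed

text \<open>Bounds for the integrand of B E l. The first commutes the factors and uses that E (1 +
  s) is a contraction; it does not decay in s. Beyond 2 |1 + l| the resolvent identity divides by l
  - (1 + s), of modulus at least s / 2, and leaves D E l and D E (1 + s) to be bounded
  separately.\<close>

lemma norm_DEE_le: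
  fixes x :: 'a
  assumes l: "Re l > 0" and s: "s > 0"
  defines "\<rho> \<equiv> cmod (1 + l)"
    and "L \<equiv> K * Re l powr (- ((1 - \<alpha>) / 2)) * cmod (1 + l) powr (- \<alpha>) * norm x"
  shows "norm (D (E (1 + of_real s) (E l x))) \<le> L"
    and "2 * \<rho> < s \<Longrightarrow> norm (D (E (1 + of_real s) (E l x)))
      \<le> 2 * K * norm x * s powr (- ((1 + \<alpha>) / 2)) + 2 * \<rho> * L / s"
proof -
  have pos: "Re (1 + complex_of_real s) > 0" using s by simp
  have "norm (D (E (1 + of_real s) (E l x)))
      \<le> K * Re l powr (- ((1 - \<alpha>) / 2)) * cmod (1 + l) powr (- \<alpha>) * norm (E (1 + of_real s) x)"
    using norm_DE_le[OF l, of "E (1 + of_real s) x"] by (simp only: E_commute[OF l pos])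
  also have "\<dots> \<le> L"
    unfolding L_def using K norm_E_real_le[of s x] s by (intro mult_left_mono) auto
  finally show "norm (D (E (1 + of_real s) (E l x))) \<le> L" .
  assume s\<rho>: "2 * \<rho> < s"
  let ?n = "norm (D (E (1 + of_real s) (E l x)))"
  \<comment> \<open>A point of the right half plane is closer to 1 than to -1.\<close>
  have \<rho>: "cmod (l - 1) \<le> \<rho>"
  proof (rule power2_le_imp_le)
    show "(cmod (l - 1))\<^sup>2 \<le> \<rho>\<^sup>2"
      unfolding \<rho>_def cmod_power2 using l by (simp add: power2_eq_square algebra_simps)
  qed (simp add: \<rho>_def)
  have "s - \<rho> \<le> cmod (l - (1 + of_real s))"
  proof -
    have "s = cmod ((l - 1) - (l - (1 + of_real s)))" using s by simp
    also have "\<dots> \<le> cmod (l - 1) + cmod (l - (1 + of_real s))" by (rule norm_triangle_ineq4)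
    finally show ?thesis using \<rho> by linarith
  qed
  then have "s / 2 * ?n \<le> cmod (l - (1 + of_real s)) * ?n"
    using s\<rho> by (intro mult_right_mono) auto
  also have "\<dots> = norm (D ((l - (1 + of_real s)) *\<^sub>C E (1 + of_real s) (E l x)))"
    by (simp add: D_simps norm_scaleC)
  also have "\<dots> = norm ((l - 1) *\<^sub>C D (E l x) - of_real s *\<^sub>C D (E (1 + of_real s) x))"
    using arg_cong[OF resolvent_identity_E(2)[OF l pos, of x], of D] by (simp add: D_simps)
  also have "\<dots> \<le> cmod (l - 1) * norm (D (E l x)) + s * norm (D (E (1 + of_real s) x))"
    using s norm_triangle_ineq4[of "(l - 1) *\<^sub>C D (E l x)" "of_real s *\<^sub>C D (E (1 + of_real s) x)"]
    by (simp add: norm_scaleC)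
  also have "\<dots> \<le> \<rho> * L + s * (K * s powr (- ((1 + \<alpha>) / 2)) * norm x)"
    using \<rho> norm_DE_le[OF l, of x] norm_DE_real_le(2)[OF s, of x] s
    unfolding L_def[symmetric] by (intro add_mono mult_mono) (auto simp: \<rho>_def)
  finally have "s / 2 * ?n \<le> \<rho> * L + s * (K * s powr (- ((1 + \<alpha>) / 2)) * norm x)" .
  then show "?n \<le> 2 * K * norm x * s powr (- ((1 + \<alpha>) / 2)) + 2 * \<rho> * L / s"
    using s by (simp add: field_simps)
qed

text \<open>The integral is split at s = 2 |1 + l|. Below this point, and in the part of the tail
  that carries L, integrating powers of s produces |1 + l|^\<alpha>, which cancels the decay |1 +
  l|^-\<alpha> in L. The rest of the tail gives |1 + l|^(-(1-\<alpha>)/2), which is at most (Re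
  l)^(-(1-\<alpha>)/2). The factors 1/\<alpha> and 1/(1-\<alpha>) come from these
  integrations.\<close>

lemma norm_BE_le:
  assumes l: "Re l > 0"
  shows "Re l powr ((1 - \<alpha>) / 2) * norm (B (E l x))
    \<le> (K * 2 powr \<alpha> * (1 / \<alpha> + 1 / (1 - \<alpha>)) + 4 * K / (1 - \<alpha>)) * norm x"
proof -
  define \<rho> where "\<rho> = cmod (1 + l)"
  define R where "R = Re l powr (- ((1 - \<alpha>) / 2))"
  define L where "L = K * R * \<rho> powr (- \<alpha>) * norm x"
  have \<rho>_Re: "Re l \<le> \<rho>" using complex_Re_le_cmod[of "1 + l"] by (simp add: \<rho>_def)
  then have \<rho>: "\<rho> > 0" using l by linarith
  have R: "Re l powr ((1 - \<alpha>) / 2) * R = 1"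
    using l by (simp add: R_def flip: powr_add)
  let ?b = "\<lambda>s. L * (indicator {..2 * \<rho>} s * s powr (\<alpha> - 1))
    + (2 * K * norm x * (indicator {2 * \<rho><..} s * s powr ((\<alpha> - 3) / 2))
      + 2 * \<rho> * L * (indicator {2 * \<rho><..} s * s powr (\<alpha> - 2)))"
  have "has_bochner_integral half_line ?b
    (L * ((2 * \<rho>) powr (\<alpha> - 1 + 1) / (\<alpha> - 1 + 1))
    + (2 * K * norm x * (- ((2 * \<rho>) powr ((\<alpha> - 3) / 2 + 1)) / ((\<alpha> - 3) / 2 + 1))
      + 2 * \<rho> * L * (- ((2 * \<rho>) powr (\<alpha> - 2 + 1)) / (\<alpha> - 2 + 1))))" (is "has_bochner_integral _ _ ?I")
    using \<rho> \<alpha> by (intro has_bochner_integral_add has_bochner_integral_mult_right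
        has_bochner_integral_powr_below has_bochner_integral_powr_above) auto
  then have b_int: "integrable half_line ?b" and b_eq: "(\<integral>s. ?b s \<partial>half_line) = ?I"
    by (simp_all only: has_bochner_integral_iff)
  have "dominated (g (E l x)) ?b"
    unfolding dominated_def
  proof (intro conjI allI impI continuous_on_g b_int)
    fix s :: real assume s: "s > 0"
    show "norm (g (E l x) s) \<le> ?b s"
    proof (cases "s \<le> 2 * \<rho>")
      case True
      then show ?thesis
        using mult_left_mono[OF norm_DEE_le(1)[OF l s, of x], of "s powr (\<alpha> - 1)"]
        by (simp add: g_def L_def \<rho>_def R_def mult_ac)
    next
      case False
      have e1: "s powr ((\<alpha> - 3) / 2) = s powr (\<alpha> - 1) * s powr (- ((1 + \<alpha>) / 2))"
      proof -
        have "(\<alpha> - 3) / 2 = (\<alpha> - 1) + - ((1 + \<alpha>) / 2)" by (simp add: field_simps)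
        then show ?thesis by (simp only: powr_add)
      qed
      have e2: "s powr (\<alpha> - 2) = s powr (\<alpha> - 1) / s"
      proof -
        have "\<alpha> - 2 = (\<alpha> - 1) - 1" by simp
        then have "s powr (\<alpha> - 2) = s powr (\<alpha> - 1) / s powr 1" by (simp only: powr_diff)
        then show ?thesis using s by simp
      qed
      have "norm (D (E (1 + of_real s) (E l x)))
        \<le> 2 * K * norm x * s powr (- ((1 + \<alpha>) / 2)) + 2 * \<rho> * L / s"
        using norm_DEE_le(2)[OF l s, of x] False by (simp add: \<rho>_def L_def R_def)
      then have "s powr (\<alpha> - 1) * norm (D (E (1 + of_real s) (E l x)))
        \<le> s powr (\<alpha> - 1) * (2 * K * norm x * s powr (- ((1 + \<alpha>) / 2)) + 2 * \<rho> * L / s)"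
        by (rule mult_left_mono) simp
      also have "\<dots> = 2 * K * norm x * s powr ((\<alpha> - 3) / 2) + 2 * \<rho> * L * s powr (\<alpha> - 2)"
        by (simp add: e1 e2 algebra_simps)
      finally show ?thesis using False by (simp add: g_def)
    qed
  qed
  then have "norm (B (E l x)) \<le> ?I"
    unfolding B_def using norm_weak_integral_le b_eq by fastforce
  also have "?I = L * (2 * \<rho>) powr \<alpha> * (1 / \<alpha> + 1 / (1 - \<alpha>)) + 4 * K / (1 - \<alpha>) * norm x * (2 * \<rho>) powr (- ((1 - \<alpha>) / 2))"
  proof -
    have "2 * \<rho> * L * (- ((2 * \<rho>) powr (\<alpha> - 2 + 1)) / (\<alpha> - 2 + 1)) = L * (2 * \<rho>) powr \<alpha> * (1 / (1 - \<alpha>))"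
    proof -
      have eq: "(2 * \<rho>) powr \<alpha> = 2 * \<rho> * (2 * \<rho>) powr (\<alpha> - 2 + 1)"
        using powr_mult_base[of "2 * \<rho>" "\<alpha> - 2 + 1"] \<rho> by simp
      have m: "- P / (\<alpha> - 2 + 1) = P / (1 - \<alpha>)" for P
        using minus_divide_divide[of P "1 - \<alpha>"] by simp
      show ?thesis unfolding m eq by simp
    qed
    moreover have "2 * K * norm x * (- ((2 * \<rho>) powr ((\<alpha> - 3) / 2 + 1)) / ((\<alpha> - 3) / 2 + 1))
      = 4 * K / (1 - \<alpha>) * norm x * (2 * \<rho>) powr (- ((1 - \<alpha>) / 2))"
    proof -
      have "(\<alpha> - 3) / 2 + 1 = - ((1 - \<alpha>) / 2)" by (simp add: field_simps)
      then show ?thesis by (simp add: mult_ac)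
    qed
    ultimately show ?thesis by (simp add: distrib_left)
  qed
  \<comment> \<open>The factor \<rho>^-\<alpha> of L disappears here; what remains depends on l only
    through R.\<close>
  also have "L * (2 * \<rho>) powr \<alpha> = K * 2 powr \<alpha> * R * norm x"
    using \<rho> by (simp add: L_def powr_mult powr_minus_divide)
  finally have "Re l powr ((1 - \<alpha>) / 2) * norm (B (E l x))
    \<le> Re l powr ((1 - \<alpha>) / 2) * (K * 2 powr \<alpha> * R * norm x * (1 / \<alpha> + 1 / (1 - \<alpha>))
      + 4 * K / (1 - \<alpha>) * norm x * (2 * \<rho>) powr (- ((1 - \<alpha>) / 2)))"
    by (rule mult_left_mono) simp
  also have "\<dots> = (Re l powr ((1 - \<alpha>) / 2) * R) * (K * 2 powr \<alpha> * norm x * (1 / \<alpha> + 1 / (1 - \<alpha>)))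
      + 4 * K / (1 - \<alpha>) * norm x * (Re l powr ((1 - \<alpha>) / 2) * (2 * \<rho>) powr (- ((1 - \<alpha>) / 2)))"
    by (simp add: algebra_simps)
  also have "\<dots> \<le> K * 2 powr \<alpha> * norm x * (1 / \<alpha> + 1 / (1 - \<alpha>)) + 4 * K / (1 - \<alpha>) * norm x * 1"
  proof -
    have "(2 * \<rho>) powr (- ((1 - \<alpha>) / 2)) \<le> R"
      unfolding R_def using \<rho>_Re \<rho> l \<alpha> by (intro powr_mono2') auto
    then have "Re l powr ((1 - \<alpha>) / 2) * (2 * \<rho>) powr (- ((1 - \<alpha>) / 2))
        \<le> Re l powr ((1 - \<alpha>) / 2) * R"
      by (rule mult_left_mono) simp
    also note R
    finally have "Re l powr ((1 - \<alpha>) / 2) * (2 * \<rho>) powr (- ((1 - \<alpha>) / 2)) \<le> 1" .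
    then show ?thesis
      unfolding R using K \<alpha> by (intro add_mono mult_left_mono) auto
  qed
  finally show ?thesis by (simp add: algebra_simps)
qed

text \<open>On the domain this is D(I - A)^(1+\<alpha>), up to the same constant factor as in
  \<open>B\<close>.\<close>

definition C :: "'a \<Rightarrow> 'b"
  where "C x = B (x - A x)"

lemma C_J1: "C (J 1 w) = B w"
  by (simp add: C_def generator_J)

lemma bounded_on_domain_C: "bounded_on_domain DA A C"
  unfolding bounded_on_domain_def
proof (intro conjI ballI allI)
  fix x y c assume "x \<in> DA"
  then obtain u where x: "x = J 1 u" by (auto simp: dom_eq_range)
  show "C (c *\<^sub>C x) = c *\<^sub>C C x"
    unfolding x by (simp add: C_J1 bounded_clinearD(2)[OF B_clinear] flip: J1_simps)
  show "C (x + y) = C x + C y" if y_dom: "y \<in> DA"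
  proof -
    obtain v where y: "y = J 1 v" using y_dom by (auto simp: dom_eq_range)
    show ?thesis
      unfolding x y by (simp add: C_J1 bounded_clinearD(3)[OF B_clinear] flip: J1_simps)
  qed
next
  have "norm (C x) \<le> onorm B * (norm x + norm (A x))" for x
  proof -
    have "norm (C x) \<le> onorm B * norm (x - A x)"
      unfolding C_def by (rule onorm[OF bounded_clinearD(1)[OF B_clinear]])
    also have "\<dots> \<le> onorm B * (norm x + norm (A x))"
      by (intro mult_left_mono norm_triangle_ineq4 onorm_pos_le bounded_clinearD(1)[OF B_clinear])
    finally show ?thesis .
  qed
  then show "\<exists>K. \<forall>x\<in>DA. norm (C x) \<le> K * (norm x + norm (A x))" by blast
qed

text \<open>R(l, A) = J 1 E l, hence C R(l, A) = B E l, and \<open>norm_BE_le\<close> is the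
  required bound.\<close>

lemma continuous_resolvent_condition_C: "continuous_resolvent_condition \<alpha> S C"
  unfolding continuous_resolvent_condition_def
proof (rule bdd_aboveI2)
  let ?M = "K * 2 powr \<alpha> * (1 / \<alpha> + 1 / (1 - \<alpha>)) + 4 * K / (1 - \<alpha>)"
  fix l assume "l \<in> {l. Re l > 0}"
  then have l: "Re l > 0" by simp
  have M: "?M \<ge> 0" using K \<alpha> by simp
  have "onorm (C \<circ> resolvent DA A l) \<le> ?M / Re l powr ((1 - \<alpha>) / 2)"
  proof (rule onorm_bound)
    show "0 \<le> ?M / Re l powr ((1 - \<alpha>) / 2)" using M by (intro divide_nonneg_nonneg) auto
    fix x
    show "norm ((C \<circ> resolvent DA A l) x) \<le> ?M / Re l powr ((1 - \<alpha>) / 2) * norm x"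
      using norm_BE_le[OF l, of x] l by (simp add: resolvent_eq_E C_J1 pos_le_divide_eq mult.commute)
  qed
  then show "Re l powr ((1 - \<alpha>) / 2) * onorm (C \<circ> resolvent DA A l) \<le> ?M"
    using l by (simp add: pos_le_divide_eq mult.commute)
qed

end

section \<open>Laguerre coefficients of the output\<close>

context contraction_semigroup
begin

lemma integrable_moment:
  fixes \<phi> :: "'a \<Rightarrow> real"
  assumes p: "p > -1" and \<phi>: "bounded_linear \<phi>"
  shows "integrable half_line (\<lambda>v. v powr p * (exp (- v) * \<phi> (S v w)))"
proof (rule dominated_integrable)
  have "has_bochner_integral half_line (\<lambda>v. v powr (p + 1 - 1) * exp (- (1 * v))) (Gamma (p + 1) / 1 powr (p + 1))"
    using p by (intro has_bochner_integral_Gamma) auto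
  then have "integrable half_line (\<lambda>v. v powr p * exp (- v))"
    by (simp add: has_bochner_integral_iff)
  then have int: "integrable half_line (\<lambda>v. onorm \<phi> * norm w * (v powr p * exp (- v)))" by simp
  show "dominated (\<lambda>v. v powr p * (exp (- v) * \<phi> (S v w))) (\<lambda>v. onorm \<phi> * norm w * (v powr p * exp (- v)))"
    unfolding dominated_def
  proof (intro conjI allI impI int)
    show "continuous_on {0<..} (\<lambda>v. v powr p * (exp (- v) * \<phi> (S v w)))"
      by (intro continuous_intros bounded_linear.continuous_on[OF \<phi>] continuous_on_subset[OF continuous_on_S]) auto
    fix v :: real assume v: "v > 0"
    have "norm (\<phi> (S v w)) \<le> onorm \<phi> * norm w"
      using v by (intro order_trans[OF onorm[OF \<phi>]] mult_left_mono norm_S_le onorm_pos_le[OF \<phi>]) auto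
    then have "v powr p * exp (- v) * norm (\<phi> (S v w)) \<le> v powr p * exp (- v) * (onorm \<phi> * norm w)"
      by (rule mult_left_mono) simp
    then show "norm (v powr p * (exp (- v) * \<phi> (S v w))) \<le> onorm \<phi> * norm w * (v powr p * exp (- v))"
      by (simp add: abs_mult mult_ac)
  qed
qed

text \<open>By the semigroup law the double integrand, apart from the powers of t and u, is a
  function of t + u alone, so \<open>Beta_convolution\<close> applies.\<close>

lemma Beta_convolution_S:
  fixes \<phi> :: "'a \<Rightarrow> real"
  assumes "a > 0" "b > 0" and \<phi>: "bounded_linear \<phi>"
  shows "(\<integral>t. t powr (a - 1) * (exp (- t) * (\<integral>u. u powr (b - 1) * (exp (- u) * \<phi> (S u (S t w))) \<partial>half_line)) \<partial>half_line)
    = Beta a b * (\<integral>v. v powr (a + b - 1) * (exp (- v) * \<phi> (S v w)) \<partial>half_line)"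
proof -
  have "(\<integral>t. t powr (a - 1) * (\<integral>u. u powr (b - 1) * (exp (- (t + u)) * \<phi> (S (t + u) w)) \<partial>half_line) \<partial>half_line)
    = Beta a b * (\<integral>v. v powr (a + b - 1) * (exp (- v) * \<phi> (S v w)) \<partial>half_line)"
  proof (rule Beta_convolution)
    show "(\<lambda>v. exp (- v) * \<phi> (S v w)) \<in> borel_measurable half_line"
      by (intro measurable_half_line_continuous continuous_intros bounded_linear.continuous_on[OF \<phi>]
          continuous_on_subset[OF continuous_on_S]) auto
    show "integrable half_line (\<lambda>v. v powr (a + b - 1) * (exp (- v) * \<phi> (S v w)))"
      using assms by (intro integrable_moment) auto
  qed (use assms in auto)
  moreover have "(\<integral>u. u powr (b - 1) * (exp (- (t + u)) * \<phi> (S (t + u) w)) \<partial>half_line)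
      = exp (- t) * (\<integral>u. u powr (b - 1) * (exp (- u) * \<phi> (S u (S t w))) \<partial>half_line)" if "t > 0" for t
  proof -
    have "(\<integral>u. u powr (b - 1) * (exp (- (t + u)) * \<phi> (S (t + u) w)) \<partial>half_line)
      = (\<integral>u. exp (- t) * (u powr (b - 1) * (exp (- u) * \<phi> (S u (S t w)))) \<partial>half_line)"
      using that by (intro Bochner_Integration.integral_cong) (auto simp: S_add add.commute[of t] exp_diff exp_minus field_simps)
    then show ?thesis by simp
  qed
  ultimately show ?thesis
    by (subst Bochner_Integration.integral_cong[OF refl, of half_line]) auto
qed

text \<open>The case b = 1 of the convolution: the inner integral is then the Laplace transform
  \<open>J 1\<close>, and Beta(\<beta>, 1) = 1 / \<beta>. Formally both sides are \<phi> applied to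
  Gamma(\<beta>+1) (I - A)^-(\<beta>+1) w.\<close>

lemma moment_J:
  fixes \<phi> :: "'a \<Rightarrow> real"
  assumes \<beta>: "\<beta> > 0" and \<phi>: "bounded_linear \<phi>"
  shows "(\<integral>v. v powr \<beta> * (exp (- v) * \<phi> (S v w)) \<partial>half_line)
    = \<beta> * (\<integral>v. v powr (\<beta> - 1) * (exp (- v) * \<phi> (S v (J 1 w))) \<partial>half_line)"
proof -
  have "(\<integral>u. u powr (1 - 1) * (exp (- u) * \<phi> (S u (S t w))) \<partial>half_line) = \<phi> (S t (J 1 w))" if "t > 0" for t
  proof -
    have "(\<integral>u. u powr (1 - 1) * (exp (- u) * \<phi> (S u (S t w))) \<partial>half_line)
        = (\<integral>u. exp (- (1 * u)) * \<phi> (S u (S t w)) \<partial>half_line)"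
      by (intro Bochner_Integration.integral_cong) auto
    also have "\<dots> = \<phi> (J 1 (S t w))" by (rule J_functional[symmetric]) (use \<phi> in auto)
    finally show ?thesis using that by (simp add: S_J)
  qed
  then have "(\<integral>t. t powr (\<beta> - 1) * (exp (- t) * (\<integral>u. u powr (1 - 1) * (exp (- u) * \<phi> (S u (S t w))) \<partial>half_line)) \<partial>half_line)
      = (\<integral>t. t powr (\<beta> - 1) * (exp (- t) * \<phi> (S t (J 1 w))) \<partial>half_line)"
    by (intro Bochner_Integration.integral_cong) auto
  moreover have "Beta \<beta> 1 = 1 / \<beta>"
    using \<beta> Gamma_real_plus1[OF \<beta>] less_imp_neq[OF Gamma_real_pos[OF \<beta>]] by (simp add: Beta_def)
  ultimately show ?thesis
    using Beta_convolution_S[OF \<beta> zero_less_one \<phi>, of w] \<beta> by simp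
qed

end

context output_estimate
begin

abbreviation J1_power :: "nat \<Rightarrow> 'a \<Rightarrow> 'a"
  where "J1_power i \<equiv> J 1 ^^ i"

text \<open>On the range of \<open>J 1\<close>, Balakrishnan's integral becomes the integral of
  s^(\<alpha>-1) R(1 + s, A). Inserting the Laplace transform and integrating over s first gives
  Gamma(\<alpha>) u^-\<alpha>, that is, the integral formula for the negative power (I -
  A)^(\<alpha>-1).\<close>

lemma B_J1:
  "B (J 1 v) \<bullet> y = Gamma \<alpha> * (\<integral>u. u powr (- \<alpha>) * (exp (- u) * (D (S u v) \<bullet> y)) \<partial>half_line)"
proof -
  define q where "q u = D (S u v) \<bullet> y" for u
  have bl: "bounded_linear (\<lambda>x. D x \<bullet> y)"
    using bounded_linear_compose[OF bounded_linear_inner_left D_linear] .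
  define F where "F = (\<lambda>(u::real, s::real). s powr (\<alpha> - 1) * (exp (- ((1 + s) * u)) * q u))"
  have q_meas: "q \<in> borel_measurable half_line"
    unfolding q_def by (intro measurable_half_line_continuous bounded_linear.continuous_on[OF bl]
        continuous_on_subset[OF continuous_on_S]) auto
  have inner: "has_bochner_integral half_line (\<lambda>s. F (u, s)) (Gamma \<alpha> * (u powr (- \<alpha>) * (exp (- u) * q u)))"
    if "u > 0" for u
  proof -
    have "has_bochner_integral half_line (\<lambda>s. (exp (- u) * q u) * (s powr (\<alpha> - 1) * exp (- (u * s))))
        ((exp (- u) * q u) * (Gamma \<alpha> / u powr \<alpha>))"
      using \<alpha> that by (intro has_bochner_integral_mult_right has_bochner_integral_Gamma) auto
    moreover have "(exp (- u) * q u) * (s powr (\<alpha> - 1) * exp (- (u * s))) = F (u, s)" for s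
      by (simp add: F_def algebra_simps flip: exp_add)
    moreover have "(exp (- u) * q u) * (Gamma \<alpha> / u powr \<alpha>) = Gamma \<alpha> * (u powr (- \<alpha>) * (exp (- u) * q u))"
      by (simp add: powr_minus_divide)
    ultimately show ?thesis by (simp only:)
  qed
  have "F = (\<lambda>p. snd p powr (\<alpha> - 1) * (exp (- ((1 + snd p) * fst p)) * q (fst p)))"
    by (auto simp: F_def)
  moreover have "\<dots> \<in> borel_measurable (half_line \<Otimes>\<^sub>M half_line)"
  proof -
    have id: "(\<lambda>x. x) \<in> borel_measurable half_line"
      by (rule measurable_half_line_borel) simp
    have [measurable]: "fst \<in> borel_measurable (half_line \<Otimes>\<^sub>M half_line)"
      using measurable_compose[OF measurable_fst id, of half_line] by simp
    have [measurable]: "snd \<in> borel_measurable (half_line \<Otimes>\<^sub>M half_line)"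
      using measurable_compose[OF measurable_snd id, of half_line] by simp
    have [measurable]: "(\<lambda>p. q (fst p)) \<in> borel_measurable (half_line \<Otimes>\<^sub>M half_line)"
      by (rule measurable_compose[OF measurable_fst q_meas])
    show ?thesis by measurable
  qed
  ultimately have F_meas: "F \<in> borel_measurable (half_line \<Otimes>\<^sub>M half_line)" by simp
  have F_int: "integrable (half_line \<Otimes>\<^sub>M half_line) F"
  proof (rule half_line_pair.Fubini_integrable[OF F_meas])
    have "(\<integral>s. norm (F (u, s)) \<partial>half_line) = Gamma \<alpha> * norm (u powr (- \<alpha>) * (exp (- u) * q u))" if "u > 0" for u
    proof -
      have "has_bochner_integral half_line (\<lambda>s. (exp (- u) * \<bar>q u\<bar>) * (s powr (\<alpha> - 1) * exp (- (u * s))))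
          ((exp (- u) * \<bar>q u\<bar>) * (Gamma \<alpha> / u powr \<alpha>))"
        using \<alpha> that by (intro has_bochner_integral_mult_right has_bochner_integral_Gamma) auto
      moreover have "(exp (- u) * \<bar>q u\<bar>) * (s powr (\<alpha> - 1) * exp (- (u * s))) = norm (F (u, s))" for s
        by (simp add: F_def abs_mult algebra_simps flip: exp_add)
      moreover have "(exp (- u) * \<bar>q u\<bar>) * (Gamma \<alpha> / u powr \<alpha>) = Gamma \<alpha> * norm (u powr (- \<alpha>) * (exp (- u) * q u))"
        by (simp add: powr_minus_divide abs_mult)
      ultimately show ?thesis by (simp only: has_bochner_integral_iff)
    qed
    moreover have "integrable half_line (\<lambda>u. Gamma \<alpha> * norm (u powr (- \<alpha>) * (exp (- u) * q u)))"
      using integrable_moment[OF _ bl, of "- \<alpha>" v] \<alpha> by (simp add: q_def)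
    ultimately show "integrable half_line (\<lambda>u. \<integral>s. norm (F (u, s)) \<partial>half_line)"
      by (subst Bochner_Integration.integrable_cong[OF refl, of half_line]) auto
    show "AE u in half_line. integrable half_line (\<lambda>s. F (u, s))"
      using inner by (intro AE_I2) (auto simp: has_bochner_integral_iff)
  qed
  have "B (J 1 v) \<bullet> y = (\<integral>s. g (J 1 v) s \<bullet> y \<partial>half_line)"
    unfolding B_def by (rule weak_integral_inner[OF dominated_g])
  also have "\<dots> = (\<integral>s. (\<integral>u. F (u, s) \<partial>half_line) \<partial>half_line)"
  proof (intro Bochner_Integration.integral_cong refl)
    fix s assume "s \<in> space half_line"
    then have s: "s > 0" by simp
    have "E (1 + of_real s) (J 1 v) = J (1 + s) v"
      using s J_eq_E[of "1 + s" v] by (simp add: E_J1_commute)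
    then have "g (J 1 v) s \<bullet> y = s powr (\<alpha> - 1) * (D (J (1 + s) v) \<bullet> y)"
      by (simp add: g_def)
    also have "D (J (1 + s) v) \<bullet> y = (\<integral>u. exp (- ((1 + s) * u)) * q u \<partial>half_line)"
      unfolding q_def by (rule J_functional[OF _ bl]) (use s in simp)
    finally show "g (J 1 v) s \<bullet> y = (\<integral>u. F (u, s) \<partial>half_line)"
      by (simp add: F_def)
  qed
  also have "\<dots> = (\<integral>u. (\<integral>s. F (u, s) \<partial>half_line) \<partial>half_line)"
    using half_line_pair.Fubini_integral[of "\<lambda>u s. F (u, s)"] F_int by simp
  also have "\<dots> = (\<integral>u. Gamma \<alpha> * (u powr (- \<alpha>) * (exp (- u) * q u)) \<partial>half_line)"
    using inner by (intro Bochner_Integration.integral_cong) (auto simp: has_bochner_integral_iff)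
  finally show ?thesis by (simp add: q_def)
qed

lemma bounded_linear_B_inner: "bounded_linear (\<lambda>x. B x \<bullet> y)"
  using bounded_linear_compose[OF bounded_linear_inner_left bounded_clinearD(1)[OF B_clinear]] .

text \<open>By the reflection formula this is \<pi> / sin(\<pi>\<alpha>), the constant by which
  \<open>B\<close> differs from D(I - A)^\<alpha>.\<close>

definition \<kappa> :: real
  where "\<kappa> = Gamma \<alpha> * Gamma (1 - \<alpha>)"

text \<open>Formally \<open>B\<close> is \<kappa> D(I - A)^\<alpha> and the moment of
  \<open>S\<close> of order \<alpha> + k is Gamma(\<alpha>+k+1) (I - A)^-(\<alpha>+k+1), so the
  fractional parts cancel and k + 1 powers of \<open>J 1\<close> remain. Only k = 0 has to deal with
  the fractional power; the induction step is \<open>moment_J\<close>.\<close>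

lemma B_moment:
  "(\<integral>t. t powr (\<alpha> + real k) * (exp (- t) * (B (S t w) \<bullet> y)) \<partial>half_line)
    = \<kappa> * Gamma (\<alpha> + real k + 1) * (D (J1_power (Suc k) w) \<bullet> y)"
proof (induction k arbitrary: w)
  case 0
  have bl: "bounded_linear (\<lambda>x. D x \<bullet> y)"
    using bounded_linear_compose[OF bounded_linear_inner_left D_linear] .
  \<comment> \<open>Lowering the exponent by one produces an argument in the range of
    \<open>J 1\<close>, as \<open>B_J1\<close> requires.\<close>
  have "(\<integral>t. t powr \<alpha> * (exp (- t) * (B (S t w) \<bullet> y)) \<partial>half_line)
      = \<alpha> * (\<integral>t. t powr (\<alpha> - 1) * (exp (- t) * (B (S t (J 1 w)) \<bullet> y)) \<partial>half_line)"
    by (rule moment_J[OF \<alpha>(1) bounded_linear_B_inner])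
  also have "(\<integral>t. t powr (\<alpha> - 1) * (exp (- t) * (B (S t (J 1 w)) \<bullet> y)) \<partial>half_line)
      = (\<integral>t. Gamma \<alpha> * (t powr (\<alpha> - 1) * (exp (- t) *
          (\<integral>u. u powr ((1 - \<alpha>) - 1) * (exp (- u) * (D (S u (S t w)) \<bullet> y)) \<partial>half_line))) \<partial>half_line)"
    by (intro Bochner_Integration.integral_cong) (auto simp: S_J B_J1)
  \<comment> \<open>The exponents \<alpha> and 1 - \<alpha> add up to 1, so the combined weight is
    v^0 and the moment is the plain Laplace transform at 1.\<close>
  also have "\<dots> = Gamma \<alpha> * (Beta \<alpha> (1 - \<alpha>) * (\<integral>v. v powr (\<alpha> + (1 - \<alpha>) - 1) * (exp (- v) * (D (S v w) \<bullet> y)) \<partial>half_line))"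
    using \<alpha> Beta_convolution_S[OF _ _ bl, of \<alpha> "1 - \<alpha>" w] by simp
  also have "(\<integral>v. v powr (\<alpha> + (1 - \<alpha>) - 1) * (exp (- v) * (D (S v w) \<bullet> y)) \<partial>half_line)
      = (\<integral>v. exp (- (1 * v)) * (D (S v w) \<bullet> y) \<partial>half_line)"
    by (intro Bochner_Integration.integral_cong) auto
  also have "\<dots> = D (J 1 w) \<bullet> y"
    by (rule J_functional[symmetric]) (use bl in auto)
  also have "\<alpha> * (Gamma \<alpha> * (Beta \<alpha> (1 - \<alpha>) * (D (J 1 w) \<bullet> y))) = \<kappa> * Gamma (\<alpha> + 1) * (D (J 1 w) \<bullet> y)"
    using Gamma_real_plus1[OF \<alpha>(1)] by (simp add: \<kappa>_def Beta_def)
  finally show ?case by simp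
next
  case (Suc k)
  have pos: "\<alpha> + real (Suc k) > 0" using \<alpha> by simp
  have "(\<integral>t. t powr (\<alpha> + real (Suc k)) * (exp (- t) * (B (S t w) \<bullet> y)) \<partial>half_line)
      = (\<alpha> + real (Suc k)) * (\<integral>t. t powr (\<alpha> + real (Suc k) - 1) * (exp (- t) * (B (S t (J 1 w)) \<bullet> y)) \<partial>half_line)"
    by (rule moment_J[OF pos bounded_linear_B_inner])
  also have "\<alpha> + real (Suc k) - 1 = \<alpha> + real k" by simp
  also note Suc.IH
  also have "\<alpha> + real k + 1 = \<alpha> + real (Suc k)" by simp
  also have "J1_power (Suc k) (J 1 w) = J1_power (Suc (Suc k)) w"
    by (simp only: funpow_Suc_right o_def)
  also have "(\<alpha> + real (Suc k)) * (\<kappa> * Gamma (\<alpha> + real (Suc k)) * (D (J1_power (Suc (Suc k)) w) \<bullet> y))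
      = \<kappa> * Gamma (\<alpha> + real (Suc k) + 1) * (D (J1_power (Suc (Suc k)) w) \<bullet> y)"
    using Gamma_real_plus1[OF pos] by (simp only: mult_ac)
  finally show ?case .
qed

lemma linear_J1_power: "linear (J1_power i)"
proof (induction i)
  case (Suc i)
  show ?case
    unfolding funpow.simps(2) by (rule linear_compose[OF Suc bounded_linear.linear[OF bounded_clinearD(1)[OF J1_clinear]]])
qed (simp add: linear_iff)

text \<open>Binomial expansion of T^n = (2 J 1 - I)^n. Replacing x by T x turns the sequence 2^i D
  (J 1)^i x into its first difference, so the induction step is
  \<open>alternating_binomial_sum_Suc\<close>.\<close>

lemma D_T_power:
  "D ((T ^^ n) x) \<bullet> y = (\<Sum>i\<le>n. (-1) ^ (n + i) * real (n choose i) * (2 ^ i * (D (J1_power i x) \<bullet> y)))"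
proof (induction n arbitrary: x)
  case 0
  then show ?case by simp
next
  case (Suc n)
  have "D ((T ^^ Suc n) x) \<bullet> y = D ((T ^^ n) (T x)) \<bullet> y" by (simp only: funpow_Suc_right o_def)
  also have "\<dots> = (\<Sum>i\<le>n. (-1) ^ (n + i) * real (n choose i) * (2 ^ i * (D (J1_power i (T x)) \<bullet> y)))"
    by (rule Suc.IH)
  also have "\<dots> = (\<Sum>i\<le>n. (-1) ^ (n + i) * real (n choose i)
      * (2 ^ Suc i * (D (J1_power (Suc i) x) \<bullet> y) - 2 ^ i * (D (J1_power i x) \<bullet> y)))"
  proof (intro sum.cong refl arg_cong2[of _ _ _ _ "(*)"])
    fix i
    have "J1_power i (T x) = 2 *\<^sub>R J1_power (Suc i) x - J1_power i x"
      unfolding T_eq funpow_Suc_right o_def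
      by (simp only: linear_diff[OF linear_J1_power] linear_scale[OF linear_J1_power])
    then have "D (J1_power i (T x)) = 2 *\<^sub>R D (J1_power (Suc i) x) - D (J1_power i x)"
      by (simp only: D_simps linear_scale[OF bounded_linear.linear[OF D_linear]])
    then show "2 ^ i * (D (J1_power i (T x)) \<bullet> y)
        = 2 ^ Suc i * (D (J1_power (Suc i) x) \<bullet> y) - 2 ^ i * (D (J1_power i x) \<bullet> y)"
      by (simp only: inner_diff_left inner_scaleR_left) (simp add: algebra_simps)
  qed
  also have "\<dots> = (\<Sum>i\<le>Suc n. (-1) ^ (Suc n + i) * real (Suc n choose i) * (2 ^ i * (D (J1_power i x) \<bullet> y)))"
    by (rule alternating_binomial_sum_Suc[symmetric])
  finally show ?case .
qed

text \<open>The factors 1 / Gamma(\<alpha>+i+1) in \<open>laguerre\<close> cancel the Gamma factors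
  of the moments, and its factors 2^i match the 2 in T = 2 J 1 - I; what is left is the binomial
  expansion of T^n.\<close>

lemma laguerre_coefficient:
  "has_bochner_integral half_line (\<lambda>t. t powr \<alpha> * (exp (- t) * laguerre \<alpha> n t) * (B (S t w) \<bullet> y))
    (\<kappa> * (D ((T ^^ n) (J 1 w)) \<bullet> y))"
proof -
  let ?c = "\<lambda>i. (-1) ^ (n + i) * real (n choose i) * 2 ^ i / Gamma (\<alpha> + real i + 1)"
  have "has_bochner_integral half_line
      (\<lambda>t. \<Sum>i\<le>n. ?c i * (t powr (\<alpha> + real i) * (exp (- t) * (B (S t w) \<bullet> y))))
      (\<Sum>i\<le>n. ?c i * (\<kappa> * Gamma (\<alpha> + real i + 1) * (D (J1_power (Suc i) w) \<bullet> y)))"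
    \<comment> \<open>With the values written as the moments themselves, only integrability has to
      be shown.\<close>
    unfolding B_moment[symmetric] using \<alpha>
    by (intro has_bochner_integral_sum has_bochner_integral_mult_right has_bochner_integral_integrable
        integrable_moment bounded_linear_B_inner) auto
  also have "(\<Sum>i\<le>n. ?c i * (\<kappa> * Gamma (\<alpha> + real i + 1) * (D (J1_power (Suc i) w) \<bullet> y)))
      = \<kappa> * (D ((T ^^ n) (J 1 w)) \<bullet> y)"
    unfolding D_T_power sum_distrib_left
  proof (intro sum.cong refl)
    fix i
    have "Gamma (\<alpha> + real i + 1) > 0" using \<alpha> by (intro Gamma_real_pos) auto
    then show "?c i * (\<kappa> * Gamma (\<alpha> + real i + 1) * (D (J1_power (Suc i) w) \<bullet> y))
        = \<kappa> * ((-1) ^ (n + i) * real (n choose i) * (2 ^ i * (D (J1_power i (J 1 w)) \<bullet> y)))"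
      by (simp only: funpow_Suc_right o_def) simp
  qed
  finally show ?thesis
    by (rule iffD1[OF has_bochner_integral_cong, rotated -1])
      (auto simp: laguerre_def powr_add powr_realpow sum_distrib_left sum_distrib_right mult_ac)
qed

lemma \<kappa>_pos: "\<kappa> > 0"
  unfolding \<kappa>_def using \<alpha> by (intro mult_pos_pos Gamma_real_pos) auto

text \<open>For x = J 1 w the output C S t x is B S t w, whose Laguerre coefficients are known. The
  Bessel inequality bounds their square sum, weighted by 1 / \<open>laguerre_norm\<close>, by the
  admissibility integral, and \<open>powr_le_Gamma_quotient\<close> extracts (1 + n)^\<alpha> from
  that weight.\<close>

lemma admissible_imp_sum_le:
  assumes adm: "(\<integral>\<^sup>+t\<in>{0..}. ennreal (t powr \<alpha> * (norm (C (S t (J 1 w))))\<^sup>2) \<partial>lborel) \<le> ennreal c" and c: "c \<ge> 0"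
  shows "\<kappa>\<^sup>2 * 2 powr (\<alpha> + 1) * Gamma (\<alpha> + 1) * (\<Sum>n<p. (1 + real n) powr \<alpha> * (norm (D ((T ^^ n) (J 1 w))))\<^sup>2) \<le> c"
proof -
  let ?f = "\<lambda>t. t powr \<alpha> * (norm (B (S t w)))\<^sup>2"
  have "continuous_on {0<..} ?f"
    by (intro continuous_intros bounded_linear.continuous_on[OF bounded_clinearD(1)[OF B_clinear]]
        continuous_on_subset[OF continuous_on_S]) auto
  then have meas: "?f \<in> borel_measurable half_line" by (rule measurable_half_line_continuous)
  have "(\<integral>\<^sup>+t. ennreal (?f t) \<partial>half_line) = (\<integral>\<^sup>+t. ennreal (?f t) * indicator {0<..} t \<partial>lborel)"
    by (subst nn_integral_restrict_space) auto
  also have "\<dots> \<le> (\<integral>\<^sup>+t\<in>{0..}. ennreal (t powr \<alpha> * (norm (C (S t (J 1 w))))\<^sup>2) \<partial>lborel)"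
    by (intro nn_integral_mono) (auto simp: indicator_def S_J C_J1)
  also note adm
  finally have nn: "(\<integral>\<^sup>+t. ennreal (?f t) \<partial>half_line) \<le> ennreal c" .
  have int: "integrable half_line ?f"
  proof (rule integrableI_bounded[OF meas])
    have "(\<integral>\<^sup>+t. ennreal (norm (?f t)) \<partial>half_line) = (\<integral>\<^sup>+t. ennreal (?f t) \<partial>half_line)" by simp
    also have "\<dots> < \<infinity>" using nn by (rule order_le_less_trans) simp
    finally show "(\<integral>\<^sup>+t. ennreal (norm (?f t)) \<partial>half_line) < \<infinity>" .
  qed
  have "\<kappa>\<^sup>2 * (2 powr (\<alpha> + 1) * (Gamma (\<alpha> + 1) * (\<Sum>n<p. (1 + real n) powr \<alpha> * (norm (D ((T ^^ n) (J 1 w))))\<^sup>2)))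
      \<le> \<kappa>\<^sup>2 * (\<Sum>n<p. (norm (D ((T ^^ n) (J 1 w))))\<^sup>2 / laguerre_norm \<alpha> n)"
    unfolding sum_distrib_left[of "2 powr _"] sum_distrib_left[of "Gamma _"]
  proof (intro mult_left_mono sum_mono)
    fix n
    have "(1 + real n) powr \<alpha> * Gamma (\<alpha> + 1) * (2 powr (\<alpha> + 1) * (norm (D ((T ^^ n) (J 1 w))))\<^sup>2)
        \<le> Gamma (\<alpha> + real n + 1) / fact n * (2 powr (\<alpha> + 1) * (norm (D ((T ^^ n) (J 1 w))))\<^sup>2)"
      by (intro mult_right_mono powr_le_Gamma_quotient \<alpha>) auto
    then show "2 powr (\<alpha> + 1) * (Gamma (\<alpha> + 1) * ((1 + real n) powr \<alpha> * (norm (D ((T ^^ n) (J 1 w))))\<^sup>2))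
        \<le> (norm (D ((T ^^ n) (J 1 w))))\<^sup>2 / laguerre_norm \<alpha> n"
      by (simp add: laguerre_norm_def mult_ac)
  qed auto
  also have "\<dots> \<le> (\<integral>t. ?f t \<partial>half_line)"
  proof (rule Bessel_inequality_weighted)
    fix n m :: nat
    show "has_bochner_integral half_line
      (\<lambda>t. t powr \<alpha> * (exp (- t) * laguerre \<alpha> n t) * (exp (- t) * laguerre \<alpha> m t))
      (if n = m then laguerre_norm \<alpha> n else 0)"
      using \<alpha> by (intro laguerre_orthogonal) auto
    show "has_bochner_integral half_line
      (\<lambda>t. t powr \<alpha> * (exp (- t) * laguerre \<alpha> n t) * (B (S t w) \<bullet> D ((T ^^ n) (J 1 w))))
      (\<kappa> * (norm (D ((T ^^ n) (J 1 w))))\<^sup>2)"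
      using laguerre_coefficient[of n w "D ((T ^^ n) (J 1 w))"] by (simp add: power2_norm_eq_inner)
  qed (use int \<alpha> in \<open>auto intro!: laguerre_norm_pos\<close>)
  also have "\<dots> \<le> c"
    using nn c by (simp add: nn_integral_eq_integral[OF int])
  finally show ?thesis by (simp add: mult_ac)
qed

text \<open>For fixed N the partial sum is continuous in x, so the estimate extends from the dense
  domain to all x; only then is the supremum over N taken.\<close>

lemma discrete_admissible_if_admissible:
  assumes "admissible \<alpha> S C"
  shows "discrete_admissible \<alpha> T D"
proof -
  obtain M where M: "M > 0" and adm: "\<And>x. x \<in> DA \<Longrightarrow>
      (\<integral>\<^sup>+t\<in>{0..}. ennreal (t powr \<alpha> * (norm (C (S t x)))\<^sup>2) \<partial>lborel) \<le> ennreal (M\<^sup>2 * (norm x)\<^sup>2)"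
    using assms unfolding admissible_def by blast
  define k where "k = \<kappa>\<^sup>2 * 2 powr (\<alpha> + 1) * Gamma (\<alpha> + 1)"
  have k: "k > 0" unfolding k_def using \<kappa>_pos \<alpha> by (intro mult_pos_pos Gamma_real_pos) auto
  let ?s = "\<lambda>N x. \<Sum>n<N. (1 + real n) powr \<alpha> * (norm (D ((T ^^ n) x)))\<^sup>2"
  have "bounded_linear (T ^^ n)" for n
  proof (induction n)
    case (Suc n)
    then show ?case
      unfolding funpow.simps(2) o_def by (rule bounded_linear_compose[OF bounded_clinearD(1)[OF T_clinear]])
  qed (simp add: id_def bounded_linear_ident)
  then have DT: "bounded_linear (\<lambda>x. D ((T ^^ n) x))" for n
    by (rule bounded_linear_compose[OF D_linear])
  have closure: "closure DA = UNIV"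
    by (auto simp: closure_approachable dist_norm) (metis dom_dense)
  have partial: "k * ?s N x - M\<^sup>2 * (norm x)\<^sup>2 \<le> 0" for N x
  proof (rule continuous_le_on_closure[where S = DA])
    show "continuous_on (closure DA) (\<lambda>x. k * ?s N x - M\<^sup>2 * (norm x)\<^sup>2)"
      by (intro continuous_intros linear_continuous_on[OF DT])
    show "k * ?s N x - M\<^sup>2 * (norm x)\<^sup>2 \<le> 0" if x: "x \<in> DA" for x
    proof -
      obtain w where w: "x = J 1 w" using x by (auto simp: dom_eq_range)
      show ?thesis
        using admissible_imp_sum_le[of w "M\<^sup>2 * (norm x)\<^sup>2" N] adm[OF x] by (simp add: w k_def)
    qed
  qed (simp_all add: closure)
  \<comment> \<open>The root of k appears because the admissibility constant enters squared.\<close>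
  have "(\<Sum>n. ennreal ((1 + real n) powr \<alpha> * (norm (D ((T ^^ n) x)))\<^sup>2)) \<le> ennreal ((M / sqrt k)\<^sup>2 * (norm x)\<^sup>2)" for x
    unfolding suminf_eq_SUP
  proof (rule SUP_least)
    fix N
    have "?s N x \<le> (M / sqrt k)\<^sup>2 * (norm x)\<^sup>2"
      using partial[of x N] k by (simp add: power_divide field_simps)
    then show "(\<Sum>n<N. ennreal ((1 + real n) powr \<alpha> * (norm (D ((T ^^ n) x)))\<^sup>2)) \<le> ennreal ((M / sqrt k)\<^sup>2 * (norm x)\<^sup>2)"
      by (subst sum_ennreal) (auto intro: ennreal_leI)
  qed
  moreover have "M / sqrt k > 0" using M k by simp
  ultimately show ?thesis unfolding discrete_admissible_def by blast
qed

end

text \<open>Under the Cayley transform the weight (1 - |z|^2)^((1-\<alpha>)/2) contributes |1 +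
  l|^-(1-\<alpha>) and the scalar 2 / (1 + l) in \<open>E l\<close> contributes |1 + l|^-1; their
  quotient is the decay |1 + l|^-\<alpha>. The constant 2^\<alpha> is 2 /
  4^((1-\<alpha>)/2).\<close>

lemma (in cogenerator) output_estimate_if_discrete_resolvent_condition:
  fixes D :: "'a \<Rightarrow> 'b::chilbert_space"
  assumes \<alpha>: "0 < \<alpha>" "\<alpha> < 1" and D: "bounded_clinear D" and drc: "discrete_resolvent_condition \<alpha> T D"
  shows "\<exists>K. output_estimate S T D \<alpha> K"
proof -
  obtain k where k: "\<And>w. cmod w < 1 \<Longrightarrow>
      (1 - (cmod w)\<^sup>2) powr ((1 - \<alpha>) / 2) * onorm (D \<circ> inv (\<lambda>x. x - cnj w *\<^sub>C T x)) \<le> k"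
    using drc unfolding discrete_resolvent_condition_def bdd_above_def by blast
  have DG: "bounded_linear (D \<circ> G z)" if "cmod z < 1" for z
    unfolding o_def using bounded_linear_compose[OF bounded_clinearD(1)[OF D] bounded_clinearD(1)[OF G_clinear[OF that]]] .
  \<comment> \<open>The condition involves the conjugate of w, so it is taken at w = cnj z, which
    has the same modulus.\<close>
  have k': "(1 - (cmod z)\<^sup>2) powr ((1 - \<alpha>) / 2) * onorm (D \<circ> G z) \<le> k" if "cmod z < 1" for z
    using k[of "cnj z"] that by (simp add: G_def)
  \<comment> \<open>At z = 0 the weight is 1, so \<open>k\<close> dominates an operator
    norm.\<close>
  have "k \<ge> 0"
    using k'[of 0] onorm_pos_le[OF DG[of 0]] by simp
  have "norm (D (E l x)) \<le> 2 powr \<alpha> * k * Re l powr (- ((1 - \<alpha>) / 2)) * cmod (1 + l) powr (- \<alpha>) * norm x"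
    if l: "Re l > 0" for l x
  proof -
    let ?z = "(1 - l) / (1 + l)" and ?\<beta> = "(1 - \<alpha>) / 2"
    have z: "cmod ?z < 1" and r: "cmod (1 + l) > 0" using cayley[OF l] by auto
    have "(4 * Re l / (cmod (1 + l))\<^sup>2) powr ?\<beta> = 2 powr (1 - \<alpha>) * Re l powr ?\<beta> * cmod (1 + l) powr (- (1 - \<alpha>))"
    proof -
      have "(4::real) powr ?\<beta> = 2 powr (1 - \<alpha>)"
        using powr_powr[of 2 2 ?\<beta>] by simp
      moreover have "((cmod (1 + l))\<^sup>2) powr ?\<beta> = cmod (1 + l) powr (1 - \<alpha>)"
      proof -
        have "2 * ?\<beta> = 1 - \<alpha>" by simp
        then show ?thesis using powr_powr[of "cmod (1 + l)" 2 ?\<beta>] r by (simp only: powr_numeral)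
      qed
      ultimately show ?thesis
        unfolding powr_minus_divide[of _ "1 - \<alpha>"] using l r by (simp add: powr_divide powr_mult)
    qed
    then have "2 powr (1 - \<alpha>) * Re l powr ?\<beta> * cmod (1 + l) powr (- (1 - \<alpha>)) * onorm (D \<circ> G ?z) \<le> k"
      using k'[OF z] cayley(3)[OF l] by simp
    \<comment> \<open>Multiplication by this factor makes the powers of 2, Re l and |1 + l| collapse
      to 2 / |1 + l|, the modulus of the scalar in \<open>E l\<close>.\<close>
    then have *: "2 powr \<alpha> * Re l powr (- ?\<beta>) * cmod (1 + l) powr (- \<alpha>)
        * (2 powr (1 - \<alpha>) * Re l powr ?\<beta> * cmod (1 + l) powr (- (1 - \<alpha>)) * onorm (D \<circ> G ?z))
        \<le> 2 powr \<alpha> * Re l powr (- ?\<beta>) * cmod (1 + l) powr (- \<alpha>) * k"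
      by (rule mult_left_mono) simp
    have "2 powr \<alpha> * Re l powr (- ?\<beta>) * cmod (1 + l) powr (- \<alpha>)
        * (2 powr (1 - \<alpha>) * Re l powr ?\<beta> * cmod (1 + l) powr (- (1 - \<alpha>)) * onorm (D \<circ> G ?z))
        = (2 powr \<alpha> * 2 powr (1 - \<alpha>)) * (Re l powr (- ?\<beta>) * Re l powr ?\<beta>)
          * (cmod (1 + l) powr (- \<alpha>) * cmod (1 + l) powr (- (1 - \<alpha>))) * onorm (D \<circ> G ?z)"
      by (simp only: mult_ac)
    also have "\<dots> = 2 / cmod (1 + l) * onorm (D \<circ> G ?z)"
    proof -
      have "2 powr \<alpha> * 2 powr (1 - \<alpha>) = (2::real)" by (simp flip: powr_add)
      moreover have "Re l powr (- ?\<beta>) * Re l powr ?\<beta> = 1"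
        using l by (simp flip: powr_add)
      moreover have "cmod (1 + l) powr (- \<alpha>) * cmod (1 + l) powr (- (1 - \<alpha>)) = cmod (1 + l) powr (- 1)"
        by (simp flip: powr_add)
      moreover have "cmod (1 + l) powr (- 1) = 1 / cmod (1 + l)"
        using r by (simp add: powr_minus_divide)
      ultimately show ?thesis by simp
    qed
    finally have DG_le: "2 / cmod (1 + l) * onorm (D \<circ> G ?z) \<le> 2 powr \<alpha> * k * Re l powr (- ?\<beta>) * cmod (1 + l) powr (- \<alpha>)"
      using * by (simp add: mult_ac)
    have "norm (D (E l x)) = 2 / cmod (1 + l) * norm ((D \<circ> G ?z) x)"
      by (simp add: E_def bounded_clinearD(2)[OF D] norm_scaleC norm_divide)
    also have "\<dots> \<le> 2 / cmod (1 + l) * (onorm (D \<circ> G ?z) * norm x)"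
      by (intro mult_left_mono onorm[OF DG[OF z]]) auto
    also have "\<dots> \<le> 2 powr \<alpha> * k * Re l powr (- ?\<beta>) * cmod (1 + l) powr (- \<alpha>) * norm x"
      using mult_right_mono[OF DG_le, of "norm x"] by (simp add: mult_ac)
    finally show ?thesis .
  qed
  then have "output_estimate S T D \<alpha> (2 powr \<alpha> * k)"
    using \<alpha> D \<open>k \<ge> 0\<close> by unfold_locales (auto simp: mult.assoc)
  then show ?thesis ..
qed

theorem theorem2p9:
  fixes \<alpha> :: real
    and T :: "'x::chilbert_space \<Rightarrow> 'x"
    and S :: "real \<Rightarrow> 'x \<Rightarrow> 'x"
  assumes "0 < \<alpha>" and "\<alpha> < 1"
    and "bounded_clinear T" and "onorm T \<le> 1"
    and "contractive_C0_semigroup S"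
    and "cogenerator_of T S"
    and "\<And>C :: 'x \<Rightarrow> 'y::chilbert_space.
           bounded_on_domain (generator_dom S) (generator S) C \<Longrightarrow>
           continuous_resolvent_condition \<alpha> S C \<Longrightarrow>
           admissible \<alpha> S C"
  shows "\<forall>D :: 'x \<Rightarrow> 'y.
           bounded_clinear D \<longrightarrow>
           discrete_resolvent_condition \<alpha> T D \<longrightarrow>
           discrete_admissible \<alpha> T D"
proof (intro allI impI)
  fix D :: "'x \<Rightarrow> 'y"
  assume D: "bounded_clinear D" "discrete_resolvent_condition \<alpha> T D"
  interpret cogenerator S T
    using assms(3-6) by unfold_locales
  obtain K where "output_estimate S T D \<alpha> K"
    using output_estimate_if_discrete_resolvent_condition[OF assms(1,2) D] by blast
  then interpret output_estimate S T D \<alpha> K .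
  show "discrete_admissible \<alpha> T D"
    by (intro discrete_admissible_if_admissible assms(7) bounded_on_domain_C continuous_resolvent_condition_C)
qed

end
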